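(* Let $m\ge 3$, $n_1\ge n_2\ge\cdots\ge n_m$ with $n_3\ge 2$, let $N_3=\frac{n_2n_3\cdots n_m}{n_3}$, and let $r\le\min(n_1,N_3)$. For a generic tensor $\mathcal{F}\in\mathbb{C}^{n_1\times\cdots\times n_m}$ of rank $r$ (that is, for all rank-$r$ tensors $\mathcal{F}$ in some nonempty Zariski open subset of $\sigma_r$) and for generic scalars $\xi=(\xi_{j,k})_{(j,k)\in\Upsilon}$ (that is, for all $\xi$ in some nonempty Zariski open subset, possibly depending on $\mathcal{F}$, of $\mathbb{C}^{\Upsilon}$), the rank-$r$ tensor decomposition algorithm described in the context, applied to $\mathcal{F}$, produces a rank-$r$ tensor decomposition of $\mathcal{F}$; i.e., its steps can be carried out and the vectors $v^{s,j}$ it outputs satisfy $$\mathcal{F}=\sum_{s=1}^r v^{s,1}\otimes v^{s,2}\otimes\cdots\otimes v^{s,m}.$$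
   Context: Outer product: $(v_1\otimes\cdots\otimes v_m)_{i_1,\ldots,i_m}=(v_1)_{i_1}\cdots(v_m)_{i_m}$. The rank of $\mathcal{F}$ (over $\mathbb{C}$) is the smallest number of outer products summing to $\mathcal{F}$. $\sigma_r$ is the Zariski closure of the set of rank-$r$ tensors in $\mathbb{C}^{n_1\times\cdots\times n_m}$ (an irreducible variety). $\mathcal{F}_{a:b,:,\ldots,:}$ is the subtensor of $\mathcal{F}$ with first index in $\{a,\ldots,b\}$. Let $\Upsilon=\{(j,k):3\le j\le m,\ 2\le k\le n_j\}$. For $j\in\{2,\ldots,m\}$, let $\mu$ range over all tuples $(i_t)_{t\in\{1,\ldots,m\}\setminus\{1,j\}}$ with $1\le i_t\le n_t$. The matrix $A[\mathcal{F},j]$ has rows labelled by $\mu$ and columns labelled by $\ell=1,\ldots,r$; its $(\mu,\ell)$ entry is the entry of $\mathcal{F}$ with first index $\ell$, $j$-th index $1$, and remaining indices given by $\mu$. The matrix $b[\mathcal{F},j,k]$ has the same labelling; its $(\mu,\ell)$ entry is the entry of $\mathcal{F}$ with first index $\ell$, $j$-th index $k$, and remaining indices given by $\mu$. Rank-$r$ tensor decomposition algorithm (input: $\mathcal{F}$ of rank $r\le\min(n_1,N_3)$): Step 1. For each $(j,k)\in\Upsilon$, solve the matrix equation $A[\mathcal{F},j]\,(Y^{j,k})^T=b[\mathcal{F},j,k]$ for $Y^{j,k}\in\mathbb{C}^{r\times r}$. Step 2. With the generic scalars $\xi_{j,k}$, compute an eigenvalue decomposition $P^{-1}YP=D$ ($P=[p_1\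 \cdots\ p_r]$ invertible, $D$ diagonal) of $$Y:=\frac{1}{\sum_{(j,k)\in\Upsilon}\xi_{j,k}}\sum_{(j,k)\in\Upsilon}\xi_{j,k}Y^{j,k}.$$ Step 3. The matrices $P^{-1}Y^{j,k}P$ being diagonal, write $P^{-1}Y^{j,k}P=\mathrm{diag}[\lambda_{j,k,1},\ldots,\lambda_{j,k,r}]$ for $(j,k)\in\Upsilon$, and for $s=1,\ldots,r$ and $j=3,\ldots,m$ let $v^{s,j}:=(1,\lambda_{j,2,s},\ldots,\lambda_{j,n_j,s})$. Step 4. Solve the linear system $\mathcal{F}_{1:r,:,\ldots,:}=\sum_{s=1}^r p_s\otimes y_s\otimes v^{s,3}\otimes\cdots\otimes v^{s,m}$ for $y_1,\ldots,y_r\in\mathbb{C}^{n_2}$. Step 5. Solve the linear system $\mathcal{F}_{r+1:n_1,:,\ldots,:}=\sum_{s=1}^r z_s\otimes y_s\otimes v^{s,3}\otimes\cdots\otimes v^{s,m}$ for $z_1,\ldots,z_r\in\mathbb{C}^{n_1-r}$ (void if $r=n_1$). Step 6. For each $s=1,\ldots,r$, let $v^{s,1}=\begin{bmatrix}p_s\\ z_s\end{bmatrix}$ and $v^{s,2}=y_s$. Output: the vectors $v^{s,j}$, $s=1,\ldots,r$, $j=1,\ldots,m$. *)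

theory Defs
  imports
    Complex_Main
    "HOL-Library.FuncSet"
    "Jordan_Normal_Form.Matrix"
begin

text \<open>
  Modes are numbered 1, ..., m as in the paper, but the entries along mode t are numbered
  0, ..., n t - 1, to agree with the matrices and vectors of Jordan_Normal_Form. Hence every entry
  index (including the k of a pair (j, k) and the s of a summand) is one less than in the paper.
  A tensor is an extensional function on multi-indices, which are extensional functions
  on the set of modes.
\<close>

section \<open>Tensors\<close>

definition multi_indices :: "nat \<Rightarrow> (nat \<Rightarrow> nat) \<Rightarrow> (nat \<Rightarrow> nat) set" where
  "multi_indices m n = (\<Pi>\<^sub>E t\<in>{1..m}. {..<n t})"

definition tensors :: "nat \<Rightarrow> (nat \<Rightarrow> nat) \<Rightarrow> ((nat \<Rightarrow> nat) \<Rightarrow> complex) set" where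
  "tensors m n = multi_indices m n \<rightarrow>\<^sub>E UNIV"

definition outer_product ::
  "nat \<Rightarrow> (nat \<Rightarrow> nat) \<Rightarrow> (nat \<Rightarrow> complex vec) \<Rightarrow> (nat \<Rightarrow> nat) \<Rightarrow> complex" where
  "outer_product m n v = (\<lambda>i\<in>multi_indices m n. \<Prod>t=1..m. v t $ i t)"

definition outer_sum ::
  "nat \<Rightarrow> (nat \<Rightarrow> nat) \<Rightarrow> nat \<Rightarrow> (nat \<Rightarrow> nat \<Rightarrow> complex vec) \<Rightarrow> (nat \<Rightarrow> nat) \<Rightarrow> complex" where
  "outer_sum m n r v = (\<lambda>i\<in>multi_indices m n. \<Sum>s<r. outer_product m n (v s) i)"

definition tensor_decomposition ::
  "nat \<Rightarrow> (nat \<Rightarrow> nat) \<Rightarrow> nat \<Rightarrow> ((nat \<Rightarrow> nat) \<Rightarrow> complex) \<Rightarrow> (nat \<Rightarrow> nat \<Rightarrow> complex vec) \<Rightarrow> bool" where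
  "tensor_decomposition m n r F v \<longleftrightarrow>
     (\<forall>s<r. \<forall>t\<in>{1..m}. v s t \<in> carrier_vec (n t)) \<and> F = outer_sum m n r v"

definition tensor_rank :: "nat \<Rightarrow> (nat \<Rightarrow> nat) \<Rightarrow> ((nat \<Rightarrow> nat) \<Rightarrow> complex) \<Rightarrow> nat" where
  "tensor_rank m n F = (LEAST r. \<exists>v. tensor_decomposition m n r F v)"

text \<open>The entries of F whose first index lies in {a..<b}, with the first index shifted to start at 0.\<close>
definition subtensor ::
  "nat \<Rightarrow> (nat \<Rightarrow> nat) \<Rightarrow> nat \<Rightarrow> nat \<Rightarrow> ((nat \<Rightarrow> nat) \<Rightarrow> complex) \<Rightarrow> (nat \<Rightarrow> nat) \<Rightarrow> complex" where
  "subtensor m n a b F = (\<lambda>i\<in>multi_indices m (n(1 := b - a)). F (i(1 := a + i 1)))"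


section \<open>Zariski topology on the affine space of families indexed by I\<close>

inductive_set polynomial_maps :: "'i set \<Rightarrow> (('i \<Rightarrow> complex) \<Rightarrow> complex) set" for I :: "'i set" where
  const: "(\<lambda>x. c) \<in> polynomial_maps I"
| coord: "i \<in> I \<Longrightarrow> (\<lambda>x. x i) \<in> polynomial_maps I"
| add: "p \<in> polynomial_maps I \<Longrightarrow> q \<in> polynomial_maps I \<Longrightarrow> (\<lambda>x. p x + q x) \<in> polynomial_maps I"
| mult: "p \<in> polynomial_maps I \<Longrightarrow> q \<in> polynomial_maps I \<Longrightarrow> (\<lambda>x. p x * q x) \<in> polynomial_maps I"

definition zariski_closed :: "'i set \<Rightarrow> ('i \<Rightarrow> complex) set \<Rightarrow> bool" where
  "zariski_closed I Z \<longleftrightarrow>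
     (\<exists>ps \<subseteq> polynomial_maps I. Z = {x \<in> I \<rightarrow>\<^sub>E UNIV. \<forall>p\<in>ps. p x = 0})"

definition zariski_closure :: "'i set \<Rightarrow> ('i \<Rightarrow> complex) set \<Rightarrow> ('i \<Rightarrow> complex) set" where
  "zariski_closure I S = \<Inter>{Z. zariski_closed I Z \<and> S \<subseteq> Z}"

definition zariski_open_in :: "'i set \<Rightarrow> ('i \<Rightarrow> complex) set \<Rightarrow> ('i \<Rightarrow> complex) set \<Rightarrow> bool" where
  "zariski_open_in I X U \<longleftrightarrow> (\<exists>Z. zariski_closed I Z \<and> U = X - Z)"

definition rank_variety :: "nat \<Rightarrow> (nat \<Rightarrow> nat) \<Rightarrow> nat \<Rightarrow> ((nat \<Rightarrow> nat) \<Rightarrow> complex) set" where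
  "rank_variety m n r =
     zariski_closure (multi_indices m n) {F \<in> tensors m n. tensor_rank m n F = r}"


section \<open>The decomposition algorithm\<close>

definition Upsilon :: "nat \<Rightarrow> (nat \<Rightarrow> nat) \<Rightarrow> (nat \<times> nat) set" where
  "Upsilon m n = {(j, k). 3 \<le> j \<and> j \<le> m \<and> 1 \<le> k \<and> k < n j}"

text \<open>Row labels of the matrices A[F, j] and b[F, j, k]; their columns are labelled by l < r.\<close>
definition row_labels :: "nat \<Rightarrow> (nat \<Rightarrow> nat) \<Rightarrow> nat \<Rightarrow> (nat \<Rightarrow> nat) set" where
  "row_labels m n j = (\<Pi>\<^sub>E t\<in>{1..m} - {1, j}. {..<n t})"

definition A_entry :: "((nat \<Rightarrow> nat) \<Rightarrow> complex) \<Rightarrow> nat \<Rightarrow> (nat \<Rightarrow> nat) \<Rightarrow> nat \<Rightarrow> complex" where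
  "A_entry F j \<mu> l = F (\<mu>(1 := l, j := 0))"

definition b_entry :: "((nat \<Rightarrow> nat) \<Rightarrow> complex) \<Rightarrow> nat \<Rightarrow> nat \<Rightarrow> (nat \<Rightarrow> nat) \<Rightarrow> nat \<Rightarrow> complex" where
  "b_entry F j k \<mu> l = F (\<mu>(1 := l, j := k))"

text \<open>The matrix equation of step 1 is written entrywise, as the row labels are not numbers.\<close>
definition step1 ::
  "nat \<Rightarrow> (nat \<Rightarrow> nat) \<Rightarrow> nat \<Rightarrow> ((nat \<Rightarrow> nat) \<Rightarrow> complex) \<Rightarrow> (nat \<Rightarrow> nat \<Rightarrow> complex mat) \<Rightarrow> bool" where
  "step1 m n r F Y \<longleftrightarrow>
     (\<forall>(j, k)\<in>Upsilon m n. Y j k \<in> carrier_mat r r \<and>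
        (\<forall>\<mu>\<in>row_labels m n j. \<forall>l<r.
           (\<Sum>l'<r. A_entry F j \<mu> l' * (Y j k)\<^sup>T $$ (l', l)) = b_entry F j k \<mu> l))"

definition averaged_mat ::
  "nat \<Rightarrow> (nat \<Rightarrow> nat) \<Rightarrow> nat \<Rightarrow> (nat \<times> nat \<Rightarrow> complex) \<Rightarrow> (nat \<Rightarrow> nat \<Rightarrow> complex mat) \<Rightarrow> complex mat" where
  "averaged_mat m n r \<xi> Y =
     (1 / (\<Sum>jk\<in>Upsilon m n. \<xi> jk)) \<cdot>\<^sub>m
       mat r r (\<lambda>(a, b). \<Sum>(j, k)\<in>Upsilon m n. \<xi> (j, k) * Y j k $$ (a, b))"

text \<open>In steps 2 and 3, Q stands for the inverse of P.\<close>
definition step2 ::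
  "nat \<Rightarrow> (nat \<Rightarrow> nat) \<Rightarrow> nat \<Rightarrow> (nat \<times> nat \<Rightarrow> complex) \<Rightarrow> (nat \<Rightarrow> nat \<Rightarrow> complex mat) \<Rightarrow>
     complex mat \<Rightarrow> complex mat \<Rightarrow> bool" where
  "step2 m n r \<xi> Y P Q \<longleftrightarrow>
     P \<in> carrier_mat r r \<and> Q \<in> carrier_mat r r \<and> inverts_mat P Q \<and> inverts_mat Q P \<and>
     diagonal_mat (Q * averaged_mat m n r \<xi> Y * P)"

definition step3 ::
  "nat \<Rightarrow> (nat \<Rightarrow> nat) \<Rightarrow> (nat \<Rightarrow> nat \<Rightarrow> complex mat) \<Rightarrow> complex mat \<Rightarrow> complex mat \<Rightarrow> bool" where
  "step3 m n Y P Q \<longleftrightarrow> (\<forall>(j, k)\<in>Upsilon m n. diagonal_mat (Q * Y j k * P))"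

definition step3_vec ::
  "(nat \<Rightarrow> nat) \<Rightarrow> (nat \<Rightarrow> nat \<Rightarrow> complex mat) \<Rightarrow> complex mat \<Rightarrow> complex mat \<Rightarrow> nat \<Rightarrow> nat \<Rightarrow> complex vec" where
  "step3_vec n Y P Q s j =
     vec (n j) (\<lambda>k. if k = 0 then 1 else (Q * Y j k * P) $$ (s, s))"

text \<open>The family x s, y s, v s 3, ..., v s m, indexed by the summand s and the mode.\<close>
definition factors ::
  "(nat \<Rightarrow> complex vec) \<Rightarrow> (nat \<Rightarrow> complex vec) \<Rightarrow> (nat \<Rightarrow> nat \<Rightarrow> complex vec) \<Rightarrow>
     nat \<Rightarrow> nat \<Rightarrow> complex vec" where
  "factors x y v s t = (if t = 1 then x s else if t = 2 then y s else v s t)"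

definition step4 ::
  "nat \<Rightarrow> (nat \<Rightarrow> nat) \<Rightarrow> nat \<Rightarrow> ((nat \<Rightarrow> nat) \<Rightarrow> complex) \<Rightarrow> complex mat \<Rightarrow>
     (nat \<Rightarrow> nat \<Rightarrow> complex vec) \<Rightarrow> (nat \<Rightarrow> complex vec) \<Rightarrow> bool" where
  "step4 m n r F P v y \<longleftrightarrow>
     (\<forall>s<r. y s \<in> carrier_vec (n 2)) \<and>
     subtensor m n 0 r F = outer_sum m (n(1 := r)) r (factors (col P) y v)"

definition step5 ::
  "nat \<Rightarrow> (nat \<Rightarrow> nat) \<Rightarrow> nat \<Rightarrow> ((nat \<Rightarrow> nat) \<Rightarrow> complex) \<Rightarrow> (nat \<Rightarrow> complex vec) \<Rightarrow>
     (nat \<Rightarrow> nat \<Rightarrow> complex vec) \<Rightarrow> (nat \<Rightarrow> complex vec) \<Rightarrow> bool" where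
  "step5 m n r F y v z \<longleftrightarrow>
     (\<forall>s<r. z s \<in> carrier_vec (n 1 - r)) \<and>
     subtensor m n r (n 1) F = outer_sum m (n(1 := n 1 - r)) r (factors z y v)"

definition algorithm_output ::
  "complex mat \<Rightarrow> (nat \<Rightarrow> complex vec) \<Rightarrow> (nat \<Rightarrow> complex vec) \<Rightarrow> (nat \<Rightarrow> nat \<Rightarrow> complex vec) \<Rightarrow>
     nat \<Rightarrow> nat \<Rightarrow> complex vec" where
  "algorithm_output P z y v = factors (\<lambda>s. col P s @\<^sub>v z s) y v"

text \<open>
  The algorithm leaves choices open: solutions of linear systems and an eigenvalue decomposition.
  Success means that, whatever was chosen in the earlier steps, each step can be carried out,
  and that every possible output is a decomposition of F.
\<close>
definition algorithm_succeeds ::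
  "nat \<Rightarrow> (nat \<Rightarrow> nat) \<Rightarrow> nat \<Rightarrow> ((nat \<Rightarrow> nat) \<Rightarrow> complex) \<Rightarrow> (nat \<times> nat \<Rightarrow> complex) \<Rightarrow> bool" where
  "algorithm_succeeds m n r F \<xi> \<longleftrightarrow>
     (\<exists>Y. step1 m n r F Y) \<and>
     (\<forall>Y. step1 m n r F Y \<longrightarrow>
        (\<Sum>jk\<in>Upsilon m n. \<xi> jk) \<noteq> 0 \<and>
        (\<exists>P Q. step2 m n r \<xi> Y P Q) \<and>
        (\<forall>P Q. step2 m n r \<xi> Y P Q \<longrightarrow>
           step3 m n Y P Q \<and>
           (let v = step3_vec n Y P Q in
              (\<exists>y. step4 m n r F P v y) \<and>
              (\<forall>y. step4 m n r F P v y \<longrightarrow>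
                 (\<exists>z. step5 m n r F y v z) \<and>
                 (\<forall>z. step5 m n r F y v z \<longrightarrow>
                    tensor_decomposition m n r F (algorithm_output P z y v))))))"

end

theory Submission
  imports Defs "Jordan_Normal_Form.Determinant"
begin

text \<open>
  Write a tensor \<open>F\<close> of rank \<open>r\<close> as a sum of outer products with factors \<open>v s t\<close> and let \<open>V\<close> be the
  matrix whose columns are the first \<open>r\<close> entries of the \<open>v s 1\<close>. A choice of \<open>r\<close> rows factors
  \<open>A[F, j]\<close> as \<open>K D V\<^sup>T\<close>, where \<open>K\<close> is a matrix of products of entries along the modes other
  than \<open>1, j\<close> and \<open>D\<close> is the diagonal matrix of the \<open>v s j $ 0\<close>. So if the minors of the
  \<open>A[F, j]\<close> do not vanish, then step 1 has the single solution \<open>Y j k = V \<Lambda> W\<close> with \<open>W\<close> inverse to \<open>V\<close> and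
  \<open>\<Lambda>\<close> the diagonal matrix of the ratios \<open>v s j $ k / v s j $ 0\<close>. If moreover the ratios for
  \<open>(j, k) = (3, 1)\<close> are distinct, then for generic weights \<open>\<xi>\<close> every eigenvector matrix \<open>P\<close> is \<open>V\<close> up
  to permutation and scaling of its columns, and the remaining steps recover the given decomposition.

  Distinctness of the ratios is a polynomial condition on \<open>F\<close>: with \<open>A = K C\<close> and \<open>B = K \<Lambda> C\<close>, the
  matrix \<open>B adj(A)\<close> is conjugate to \<open>det(A) \<Lambda>\<close>, and a Krylov determinant of it is a multiple of the
  Vandermonde determinant of the ratios. None of the conditions fails identically because \<open>v s 1 = e s\<close>
  and \<open>v s t $ i = 2 ^ (s * n 1 ^ t * i)\<close> turn all the matrices \<open>K\<close> into Vandermonde matrices.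
\<close>

section \<open>Polynomial maps and principal open sets\<close>

lemma polynomial_maps_sum:
  assumes "\<And>a. a \<in> S \<Longrightarrow> f a \<in> polynomial_maps I"
  shows "(\<lambda>x. \<Sum>a\<in>S. f a x) \<in> polynomial_maps I"
  using assms
  by (induction S rule: infinite_finite_induct)
    (auto intro: polynomial_maps.const polynomial_maps.add)

lemma polynomial_maps_prod:
  assumes "\<And>a. a \<in> S \<Longrightarrow> f a \<in> polynomial_maps I"
  shows "(\<lambda>x. \<Prod>a\<in>S. f a x) \<in> polynomial_maps I"
  using assms
  by (induction S rule: infinite_finite_induct)
    (auto intro: polynomial_maps.const polynomial_maps.mult)

text \<open>The size is demanded at every argument, so that determinants and adjugates unfold
  without side conditions on x.\<close>

definition polynomial_mats ::
  "'i set \<Rightarrow> nat \<Rightarrow> nat \<Rightarrow> (('i \<Rightarrow> complex) \<Rightarrow> complex mat) set" where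
  "polynomial_mats I a b = {X. (\<forall>x. X x \<in> carrier_mat a b) \<and>
     (\<forall>i<a. \<forall>j<b. (\<lambda>x. X x $$ (i, j)) \<in> polynomial_maps I)}"

lemma polynomial_mats_mat:
  assumes "\<And>i j. i < a \<Longrightarrow> j < b \<Longrightarrow> (\<lambda>x. f x i j) \<in> polynomial_maps I"
  shows "(\<lambda>x. mat a b (\<lambda>(i, j). f x i j)) \<in> polynomial_mats I a b"
  using assms unfolding polynomial_mats_def by auto

lemma polynomial_mats_carrier: "X \<in> polynomial_mats I a b \<Longrightarrow> X x \<in> carrier_mat a b"
  unfolding polynomial_mats_def by auto

lemma polynomial_mats_entry:
  "X \<in> polynomial_mats I a b \<Longrightarrow> i < a \<Longrightarrow> j < b \<Longrightarrow> (\<lambda>x. X x $$ (i, j)) \<in> polynomial_maps I"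
  unfolding polynomial_mats_def by auto

lemma polynomial_mats_mult:
  assumes X: "X \<in> polynomial_mats I a b" and Y: "Y \<in> polynomial_mats I b c"
  shows "(\<lambda>x. X x * Y x) \<in> polynomial_mats I a c"
proof -
  note XY = polynomial_mats_carrier[OF X] polynomial_mats_carrier[OF Y]
  have "(X x * Y x) $$ (i, j) = (\<Sum>l<b. X x $$ (i, l) * Y x $$ (l, j))"
    if "i < a" "j < c" for x i j
    using XY[of x] that by (auto simp: scalar_prod_def atLeast0LessThan intro!: sum.cong)
  moreover have "(\<lambda>x. \<Sum>l<b. X x $$ (i, l) * Y x $$ (l, j)) \<in> polynomial_maps I"
    if "i < a" "j < c" for i j
    using that by (intro polynomial_maps_sum polynomial_maps.mult)
      (auto intro: polynomial_mats_entry[OF X] polynomial_mats_entry[OF Y])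
  ultimately show ?thesis
    using mult_carrier_mat[OF XY] unfolding polynomial_mats_def by auto
qed

text \<open>The Leibniz expansion is a signed sum of products of entries.\<close>

lemma polynomial_maps_det:
  assumes X: "X \<in> polynomial_mats I a a"
  shows "(\<lambda>x. det (X x)) \<in> polynomial_maps I"
  unfolding det_def'[OF polynomial_mats_carrier[OF X]]
  by (intro polynomial_maps_sum polynomial_maps.mult polynomial_maps.const polynomial_maps_prod
      polynomial_mats_entry[OF X]) (auto simp: permutes_in_image)

text \<open>Entries of the adjugate are signed minors. In \<open>krylov_mat\<close> it stands in for
  the inverse, whose entries would only be rational functions.\<close>

lemma polynomial_mats_adj_mat:
  assumes X: "X \<in> polynomial_mats I a a"
  shows "(\<lambda>x. adj_mat (X x)) \<in> polynomial_mats I a a"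
proof -
  note dims = polynomial_mats_carrier[OF X, THEN carrier_matD(1)]
    polynomial_mats_carrier[OF X, THEN carrier_matD(2)]
  have "(\<lambda>x. mat_delete (X x) j i) \<in> polynomial_mats I (a - 1) (a - 1)" for i j
    unfolding mat_delete_def dims
    by (rule polynomial_mats_mat, rule polynomial_mats_entry[OF X]) auto
  then show ?thesis
    unfolding adj_mat_def cofactor_def dims
    by (intro polynomial_mats_mat polynomial_maps.mult polynomial_maps.const polynomial_maps_det)
qed

lemma polynomial_mats_power:
  assumes X: "X \<in> polynomial_mats I a a"
  shows "(\<lambda>x. X x ^\<^sub>m c) \<in> polynomial_mats I a a"
proof (induction c)
  case 0
  have "(\<lambda>x. mat a a (\<lambda>(i, j). if i = j then 1 else 0)) \<in> polynomial_mats I a a"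
    by (intro polynomial_mats_mat) (auto intro: polynomial_maps.const)
  then show ?case
    using polynomial_mats_carrier[OF X, THEN carrier_matD(1)] by (simp add: one_mat_def)
next
  case (Suc c)
  then show ?case
    using polynomial_mats_mult[OF Suc X] by simp
qed

text \<open>Zariski closed sets contain only extensional functions. Hence X has to lie in the affine
  space, or zeros of p outside it would survive the removal of the closed set.\<close>

lemma zariski_open_in_nonzero:
  assumes "p \<in> polynomial_maps I" and "X \<subseteq> I \<rightarrow>\<^sub>E UNIV"
  shows "zariski_open_in I X {x \<in> X. p x \<noteq> 0}"
  unfolding zariski_open_in_def zariski_closed_def
proof (intro exI conjI)
  show "{p} \<subseteq> polynomial_maps I"
    using assms by simp
  show "{x \<in> X. p x \<noteq> 0} = X - {x \<in> I \<rightarrow>\<^sub>E UNIV. \<forall>q\<in>{p}. q x = 0}"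
    using assms by auto
qed auto

lemma zariski_closure_subset_space:
  assumes "S \<subseteq> I \<rightarrow>\<^sub>E UNIV"
  shows "zariski_closure I S \<subseteq> I \<rightarrow>\<^sub>E UNIV"
proof -
  have "zariski_closed I (I \<rightarrow>\<^sub>E UNIV)"
    \<comment> \<open>The empty set of equations cuts out the whole space, which therefore takes
      part in the intersection defining the closure.\<close>
    unfolding zariski_closed_def by (rule exI[of _ "{}"]) auto
  then show ?thesis
    using assms unfolding zariski_closure_def by auto
qed

lemma zariski_closure_superset: "S \<subseteq> zariski_closure I S"
  unfolding zariski_closure_def by auto


section \<open>Diagonal and Vandermonde matrices\<close>

definition diag_of :: "nat \<Rightarrow> (nat \<Rightarrow> 'a::zero) \<Rightarrow> 'a mat" where
  "diag_of r d = mat r r (\<lambda>(i, j). if i = j then d i else 0)"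

lemma diag_of_carrier [simp]: "diag_of r d \<in> carrier_mat r r"
  unfolding diag_of_def by simp

lemma diag_of_dim [simp]: "dim_row (diag_of r d) = r" "dim_col (diag_of r d) = r"
  unfolding diag_of_def by simp_all

lemma mult_mat_index:
  fixes A B :: "'a::semiring_0 mat"
  assumes "A \<in> carrier_mat a b" "B \<in> carrier_mat b c" "i < a" "j < c"
  shows "(A * B) $$ (i, j) = (\<Sum>l<b. A $$ (i, l) * B $$ (l, j))"
  using assms by (auto simp: scalar_prod_def atLeast0LessThan intro!: sum.cong)

lemma mult_diag_of_index:
  fixes A :: "'a::semiring_0 mat"
  assumes "A \<in> carrier_mat a r" "i < a" "j < r"
  shows "(A * diag_of r d) $$ (i, j) = A $$ (i, j) * d j"
proof -
  have "(A * diag_of r d) $$ (i, j) = (\<Sum>l<r. if l = j then A $$ (i, l) * d l else 0)"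
    unfolding mult_mat_index[OF assms(1) diag_of_carrier assms(2,3)]
    using assms by (intro sum.cong) (auto simp: diag_of_def)
  then show ?thesis
    using assms by simp
qed

lemma diag_of_mult_index:
  fixes A :: "'a::semiring_0 mat"
  assumes "A \<in> carrier_mat r b" "i < r" "j < b"
  shows "(diag_of r d * A) $$ (i, j) = d i * A $$ (i, j)"
proof -
  have "(diag_of r d * A) $$ (i, j) = (\<Sum>l<r. if i = l then d i * A $$ (l, j) else 0)"
    unfolding mult_mat_index[OF diag_of_carrier assms]
    using assms by (intro sum.cong) (auto simp: diag_of_def)
  then show ?thesis
    using assms by simp
qed

lemma diag_of_mult_diag_of:
  fixes d e :: "nat \<Rightarrow> 'a::semiring_0"
  shows "diag_of r d * diag_of r e = diag_of r (\<lambda>s. d s * e s)"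
proof (rule eq_matI)
  fix i j assume "i < dim_row (diag_of r (\<lambda>s. d s * e s))" "j < dim_col (diag_of r (\<lambda>s. d s * e s))"
  then show "(diag_of r d * diag_of r e) $$ (i, j) = diag_of r (\<lambda>s. d s * e s) $$ (i, j)"
    using mult_diag_of_index[OF diag_of_carrier, of i r j d e] by (simp add: diag_of_def)
qed auto

lemma det_diag_of: "det (diag_of r d) = (\<Prod>i<r. d i :: 'a::comm_ring_1)"
proof -
  have "det (diag_of r d) = prod_list (diag_mat (diag_of r d))"
    by (rule det_upper_triangular[of _ r]) (auto simp: upper_triangular_def diag_of_def)
  also have "diag_mat (diag_of r d) = map d [0..<r]"
    by (auto simp: diag_mat_def diag_of_def)
  finally show ?thesis
    by (simp add: prod.list_conv_set_nth atLeast0LessThan)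
qed

text \<open>A nonzero kernel vector would be the coefficient vector of a nonzero polynomial of
  degree below r that vanishes at r distinct nodes.\<close>

lemma det_vandermonde_nonzero:
  fixes x :: "nat \<Rightarrow> 'a::field"
  assumes "inj_on x {..<r}"
  shows "det (mat r r (\<lambda>(i, j). x i ^ j)) \<noteq> 0"
proof
  let ?A = "mat r r (\<lambda>(i, j). x i ^ j)"
  assume "det ?A = 0"
  then obtain c where c: "c \<in> carrier_vec r" "c \<noteq> 0\<^sub>v r" "?A *\<^sub>v c = 0\<^sub>v r"
    using det_0_iff_vec_prod_zero[of ?A r] by auto
  define p where "p = (\<Sum>j<r. monom (c $ j) j)"
  have coeff: "coeff p j = (if j < r then c $ j else 0)" for j
    unfolding p_def by (simp add: coeff_sum sum.delta)
  have root: "poly p (x i) = 0" if "i < r" for i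
  proof -
    have "poly p (x i) = (?A *\<^sub>v c) $ i"
      using that c(1)
      by (auto simp: p_def poly_sum poly_monom scalar_prod_def atLeast0LessThan mult.commute
          intro!: sum.cong)
    then show ?thesis
      using c(3) that by simp
  qed
  have "p \<noteq> 0"
  proof
    assume "p = 0"
    then have "c = 0\<^sub>v r"
      using coeff c(1) by (intro eq_vecI) (auto, metis coeff_0)
    then show False
      using c(2) by simp
  qed
  have "r \<noteq> 0"
    using c(1,2) by (metis carrier_vecD eq_vecI index_zero_vec(2) not_less_zero)
  have "degree p < r"
    using \<open>r \<noteq> 0\<close> coeff by (intro degree_lessI) auto
  moreover have "card (x ` {..<r}) \<le> card {y. poly p y = 0}"
    using root \<open>p \<noteq> 0\<close> by (intro card_mono poly_roots_finite) auto
  moreover have "card {y. poly p y = 0} \<le> degree p"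
    using \<open>p \<noteq> 0\<close> by (rule card_poly_roots_bound)
  ultimately show False
    using card_image[OF assms] by simp
qed

lemma mult_mat_inverse_exists:
  fixes A :: "'a::field mat"
  assumes A: "A \<in> carrier_mat r r" and "det A \<noteq> 0"
  obtains B where "B \<in> carrier_mat r r" "A * B = 1\<^sub>m r" "B * A = 1\<^sub>m r"
proof -
  define B where "B = inverse (det A) \<cdot>\<^sub>m adj_mat A"
  show thesis
  proof (rule that[of B])
    show "B \<in> carrier_mat r r" "A * B = 1\<^sub>m r" "B * A = 1\<^sub>m r"
      unfolding B_def using adj_mat[OF A] A assms(2)
      by (auto simp: mult_smult_distrib[OF A adj_mat(1)[OF A]]
          mult_smult_assoc_mat[OF adj_mat(1)[OF A] A])
  qed
qed

text \<open>Independence of columns in terms of sums, the form in which it is needed for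
  \<open>mode_prod_independent\<close> and for the uniqueness in step 4.\<close>

lemma sum_mult_eq_0_imp_eq_0:
  fixes A :: "'a::field mat"
  assumes A: "A \<in> carrier_mat r r" and "det A \<noteq> 0"
    and "\<And>i. i < r \<Longrightarrow> (\<Sum>s<r. A $$ (i, s) * c s) = 0" and "s < r"
  shows "c s = 0"
proof -
  have "A *\<^sub>v vec r c = 0\<^sub>v r"
    using assms by (intro eq_vecI) (auto simp: scalar_prod_def atLeast0LessThan)
  then have "vec r c = 0\<^sub>v r"
    using det_0_iff_vec_prod_zero[OF A] assms(2) vec_carrier by blast
  then show ?thesis
    using \<open>s < r\<close> by (metis index_vec index_zero_vec(1))
qed

text \<open>Since the entries of w are distinct, the eigenspaces of \<open>diag_of r w\<close> are
  the coordinate lines. Each column of R is an eigenvector, so it has exactly one nonzero entry, in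
  row \<pi> b, and R is a monomial matrix. Conjugation by a monomial matrix permutes the entries of
  every diagonal matrix, not only those of w.\<close>

lemma diagonalizing_distinct_diagonal:
  fixes R S :: "'a::field mat"
  assumes R: "R \<in> carrier_mat r r" and S: "S \<in> carrier_mat r r"
    and SR: "S * R = 1\<^sub>m r" and RS: "R * S = 1\<^sub>m r"
    and inj: "inj_on w {..<r}" and D: "diagonal_mat (S * diag_of r w * R)"
  obtains \<pi> \<rho> where "bij_betw \<pi> {..<r} {..<r}" "\<And>b. b < r \<Longrightarrow> \<rho> b \<noteq> 0"
    "\<And>a b. a < r \<Longrightarrow> b < r \<Longrightarrow> R $$ (a, b) = (if a = \<pi> b then \<rho> b else 0)"
    "\<And>z. S * diag_of r z * R = diag_of r (\<lambda>b. z (\<pi> b))"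
proof -
  let ?D = "S * diag_of r w * R"
  have Dc: "?D \<in> carrier_mat r r"
    using R S by auto
  have "diag_of r w * R \<in> carrier_mat r r"
    using R by (rule mult_carrier_mat[OF diag_of_carrier])
  moreover from this have "R * ?D = (R * S) * (diag_of r w * R)"
    using R S by (simp only: assoc_mult_mat[OF S diag_of_carrier R] assoc_mult_mat[OF R S])
  ultimately have "R * ?D = diag_of r w * R"
    using RS left_mult_one_mat[of "diag_of r w * R" r r] by simp
  \<comment> \<open>Comparing entries (a, b) in R D = diag(w) R: a nonzero entry of column b can
    only sit in a row whose w is the eigenvalue of that column.\<close>
  have eigen: "w a = ?D $$ (b, b)" if "a < r" "b < r" "R $$ (a, b) \<noteq> 0" for a b
  proof -
    have "?D $$ (c, b) = 0" if "c < r" "c \<noteq> b" for c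
      using D that \<open>b < r\<close> unfolding diagonal_mat_def carrier_matD[OF Dc] by blast
    then have "(R * ?D) $$ (a, b) = (\<Sum>c<r. if c = b then R $$ (a, c) * ?D $$ (c, b) else 0)"
      unfolding mult_mat_index[OF R Dc that(1,2)]
      by (intro sum.cong) (simp_all del: index_mult_mat)
    then have "(R * ?D) $$ (a, b) = R $$ (a, b) * ?D $$ (b, b)"
      using that(2) by simp
    then show ?thesis
      using that \<open>R * ?D = diag_of r w * R\<close> diag_of_mult_index[OF R that(1,2), of w] by simp
  qed
  have SR_index: "(\<Sum>c<r. S $$ (a, c) * R $$ (c, b)) = (if a = b then 1 else 0)"
    if "a < r" "b < r" for a b
    using mult_mat_index[OF S R that] that unfolding SR by simp
  have "\<exists>a<r. R $$ (a, b) \<noteq> 0" if "b < r" for b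
  proof (rule ccontr)
    assume "\<not> (\<exists>a<r. R $$ (a, b) \<noteq> 0)"
    then have "(\<Sum>c<r. S $$ (b, c) * R $$ (c, b)) = 0"
      by (intro sum.neutral) auto
    then show False
      using SR_index[OF that that] by simp
  qed
  then obtain \<pi> where \<pi>: "\<And>b. b < r \<Longrightarrow> \<pi> b < r \<and> R $$ (\<pi> b, b) \<noteq> 0"
    by metis
  define \<rho> where "\<rho> b = R $$ (\<pi> b, b)" for b
  have R_eq: "R $$ (a, b) = (if a = \<pi> b then \<rho> b else 0)" if "a < r" "b < r" for a b
  proof (cases "a = \<pi> b \<or> R $$ (a, b) = 0")
    case False
    then have "w a = ?D $$ (b, b)"
      by (intro eigen that) simp
    also have "?D $$ (b, b) = w (\<pi> b)"
      using \<pi>[OF that(2)] that(2) by (intro eigen[symmetric]) auto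
    finally show ?thesis
      using inj_onD[OF inj] \<pi>[OF that(2)] that False by auto
  qed (auto simp: \<rho>_def)
  have S_eq: "S $$ (a, \<pi> b) * \<rho> b = (if a = b then 1 else 0)" if "a < r" "b < r" for a b
  proof -
    have "(\<Sum>c<r. S $$ (a, c) * R $$ (c, b)) = (\<Sum>c<r. if c = \<pi> b then S $$ (a, c) * \<rho> b else 0)"
      using R_eq that by (intro sum.cong) auto
    then show ?thesis
      using \<pi>[OF that(2)] SR_index[OF that] by simp
  qed
  \<comment> \<open>If \<pi> a = \<pi> b with a and b distinct, then \<open>S_eq\<close> makes S (a,
    \<pi> a) nonzero and S (a, \<pi> b) zero.\<close>
  have "inj_on \<pi> {..<r}"
  proof (rule inj_onI)
    fix a b assume "a \<in> {..<r}" "b \<in> {..<r}" "\<pi> a = \<pi> b"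
    then show "a = b"
      using S_eq[of a a] S_eq[of a b] \<pi>[of b]
      by (cases "a = b") (auto simp: \<rho>_def)
  qed
  then have bij: "bij_betw \<pi> {..<r} {..<r}"
    using \<pi> by (intro endo_inj_surj bij_betw_imageI) auto
  have diag: "S * diag_of r z * R = diag_of r (\<lambda>b. z (\<pi> b))" for z
  proof (rule eq_matI)
    fix a b assume "a < dim_row (diag_of r (\<lambda>b. z (\<pi> b)))" "b < dim_col (diag_of r (\<lambda>b. z (\<pi> b)))"
    then have ab: "a < r" "b < r"
      by (auto simp: diag_of_def)
    have Sz: "S * diag_of r z \<in> carrier_mat r r"
      using S by auto
    have "(S * diag_of r z * R) $$ (a, b)
        = (\<Sum>c<r. if c = \<pi> b then S $$ (a, c) * \<rho> b * z c else 0)"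
      unfolding mult_mat_index[OF Sz R ab]
      using ab by (intro sum.cong) (simp_all add: R_eq mult_diag_of_index[OF S])
    also have "\<dots> = (if a = b then z (\<pi> b) else 0)"
      using \<pi>[OF ab(2)] S_eq[OF ab] by simp
    finally show "(S * diag_of r z * R) $$ (a, b) = diag_of r (\<lambda>b. z (\<pi> b)) $$ (a, b)"
      using ab by (simp add: diag_of_def)
  qed (use R S in \<open>auto simp: diag_of_def\<close>)
  have nonzero: "\<rho> b \<noteq> 0" if "b < r" for b
    using \<pi>[OF that] by (simp add: \<rho>_def)
  show thesis
    by (rule that[OF bij nonzero R_eq diag])
qed


section \<open>Entries of sums of outer products\<close>

text \<open>As \<mu> runs through the row labels, these are the entries of the outer product of the
  vectors in the modes other than 1 and j. Taken for all v s, they are the columns of a Khatri-Rao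
  product.\<close>

definition mode_prod :: "nat \<Rightarrow> nat \<Rightarrow> (nat \<Rightarrow> complex vec) \<Rightarrow> (nat \<Rightarrow> nat) \<Rightarrow> complex" where
  "mode_prod m j v \<mu> = (\<Prod>t\<in>{1..m} - {1, j}. v t $ \<mu> t)"

lemma outer_sum_entry:
  "i \<in> multi_indices m n \<Longrightarrow> outer_sum m n r v i = (\<Sum>s<r. \<Prod>t=1..m. v s t $ i t)"
  by (simp add: outer_sum_def outer_product_def)

lemma outer_sum_in_tensors: "outer_sum m n r v \<in> tensors m n"
  unfolding outer_sum_def tensors_def by simp

lemma update_in_multi_indices:
  assumes "\<mu> \<in> row_labels m n j" "l < n 1" "k < n j" "2 \<le> j" "j \<le> m"
  shows "\<mu>(1 := l, j := k) \<in> multi_indices m n"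
  unfolding multi_indices_def
proof (rule PiE_I)
  fix t assume "t \<in> {1..m}"
  then show "(\<mu>(1 := l, j := k)) t \<in> {..<n t}"
    using assms PiE_mem[OF assms(1)[unfolded row_labels_def], of t] by auto
next
  fix t assume "t \<notin> {1..m}"
  then show "(\<mu>(1 := l, j := k)) t = undefined"
    using assms(4,5) PiE_arb[OF assms(1)[unfolded row_labels_def], of t] by auto
qed

text \<open>Splitting modes 1 and j off the product exhibits the entries of A[F, j] (for k = 0) and
  of b[F, j, k] as entries of a product of matrices.\<close>

lemma outer_sum_update:
  assumes "\<mu> \<in> row_labels m n j" "l < n 1" "k < n j" "2 \<le> j" "j \<le> m"
  shows "outer_sum m n r v (\<mu>(1 := l, j := k)) =
    (\<Sum>s<r. mode_prod m j (v s) \<mu> * v s j $ k * v s 1 $ l)"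
  unfolding outer_sum_entry[OF update_in_multi_indices[OF assms]]
proof (rule sum.cong)
  fix s
  have "{1..m} = insert 1 (insert j ({1..m} - {1, j}))" "1 \<noteq> j"
    using assms by auto
  then have "prod f {1..m} = f 1 * (f j * prod f ({1..m} - {1, j}))" for f :: "nat \<Rightarrow> complex"
    using prod.insert[of "insert j ({1..m} - {1, j})" 1 f] prod.insert[of "{1..m} - {1, j}" j f]
    by auto
  then have "(\<Prod>t=1..m. v s t $ (\<mu>(1 := l, j := k)) t) =
      v s 1 $ l * (v s j $ k * (\<Prod>t\<in>{1..m} - {1, j}. v s t $ (\<mu>(1 := l, j := k)) t))"
    using \<open>1 \<noteq> j\<close> by simp
  also have "(\<Prod>t\<in>{1..m} - {1, j}. v s t $ (\<mu>(1 := l, j := k)) t) = mode_prod m j (v s) \<mu>"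
    unfolding mode_prod_def by (intro prod.cong) auto
  finally show "(\<Prod>t=1..m. v s t $ (\<mu>(1 := l, j := k)) t) =
      mode_prod m j (v s) \<mu> * v s j $ k * v s 1 $ l"
    by (simp only: mult_ac)
qed simp

lemma prod_factors:
  assumes "3 \<le> m"
  shows "(\<Prod>t=1..m. factors x y w s t $ i t) =
    x s $ i 1 * (y s $ i 2 * (\<Prod>t=3..m. w s t $ i t))"
proof -
  have "{1..m} = insert 1 (insert 2 {3..m})"
    using assms by auto
  then have "prod f {1..m} = f 1 * (f 2 * prod f {3..m})" for f :: "nat \<Rightarrow> complex"
    using prod.insert[of "insert 2 {3..m}" 1 f] prod.insert[of "{3..m}" 2 f] by auto
  then have "(\<Prod>t=1..m. factors x y w s t $ i t) =
      x s $ i 1 * (y s $ i 2 * (\<Prod>t=3..m. factors x y w s t $ i t))"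
    by (simp add: factors_def)
  also have "(\<Prod>t=3..m. factors x y w s t $ i t) = (\<Prod>t=3..m. w s t $ i t)"
    by (intro prod.cong) (auto simp: factors_def)
  finally show ?thesis .
qed

text \<open>Every tensor is a combination of the tensors with a single entry 1. Without some
  decomposition the \<open>LEAST\<close> in \<open>tensor_rank\<close> would carry no
  information.\<close>

lemma exists_tensor_decomposition:
  assumes F: "F \<in> tensors m n" and m: "1 \<le> m"
  shows "\<exists>r v. tensor_decomposition m n r F v"
proof -
  let ?M = "multi_indices m n"
  have "finite ?M"
    unfolding multi_indices_def by (intro finite_PiE) auto
  then obtain h where h: "bij_betw h {..<card ?M} ?M"
    using ex_bij_betw_nat_finite[of ?M] by (auto simp: atLeast0LessThan)
  \<comment> \<open>The summand s is the unit tensor at the multi-index h s. Its coefficient is put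
    into mode 1 alone, so that it occurs once in the product.\<close>
  define v where "v s t = vec (n t) (\<lambda>k. (if k = h s t then 1 else 0) * (if t = 1 then F (h s) else 1))"
    for s t
  have "(\<Sum>s<card ?M. \<Prod>t=1..m. v s t $ i t) = F i" if i: "i \<in> ?M" for i
  proof -
    have "(\<Prod>t=1..m. v s t $ i t) = (if i = h s then F (h s) else 0)" if "s < card ?M" for s
    proof -
      have hs: "h s \<in> ?M"
        using h that by (auto simp: bij_betw_def)
      have "v s t $ i t = (if i t = h s t then 1 else 0) * (if t = 1 then F (h s) else 1)"
        if "t \<in> {1..m}" for t
        using that i by (auto simp: v_def multi_indices_def PiE_iff)
      then have "(\<Prod>t=1..m. v s t $ i t) =
          (\<Prod>t=1..m. if i t = h s t then 1 else 0) * (\<Prod>t=1..m. if t = 1 then F (h s) else 1)"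
        by (simp add: prod.distrib)
      also have "(\<Prod>t=1..m. if t = 1 then F (h s) else 1) = F (h s)"
        using m by (simp add: prod.delta)
      also have "(\<Prod>t=1..m. if i t = h s t then 1 else 0) = (if i = h s then 1 else (0 :: complex))"
      proof (cases "i = h s")
        case False
        then obtain t where "t \<in> {1..m}" "i t \<noteq> h s t"
          using i hs unfolding multi_indices_def by (meson PiE_ext)
        then show ?thesis
          using False by (auto intro!: prod_zero)
      qed simp
      finally show ?thesis
        by simp
    qed
    then have "(\<Sum>s<card ?M. \<Prod>t=1..m. v s t $ i t) = (\<Sum>s<card ?M. if i = h s then F (h s) else 0)"
      by (intro sum.cong) auto
    also have "\<dots> = (\<Sum>j\<in>?M. if i = j then F j else 0)"
      using sum.reindex_bij_betw[OF h, of "\<lambda>j. if i = j then F j else 0"] by simp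
    also have "\<dots> = F i"
      using i \<open>finite ?M\<close> by simp
    finally show ?thesis .
  qed
  then have "F = outer_sum m n (card ?M) v"
    using F unfolding tensors_def
    by (intro extensionalityI[of _ ?M]) (auto simp: PiE_iff outer_sum_entry simp flip: One_nat_def,
        auto simp: outer_sum_def)
  then show ?thesis
    unfolding tensor_decomposition_def by (intro exI[of _ "card ?M"] exI[of _ v]) (auto simp: v_def)
qed

lemma tensor_rank_decomposition:
  assumes "F \<in> tensors m n" "1 \<le> m"
  obtains v where "tensor_decomposition m n (tensor_rank m n F) F v"
  using LeastI_ex[OF exists_tensor_decomposition[OF assms]] unfolding tensor_rank_def by blast

text \<open>Each added term vanishes because of its zero vector in mode 1. Padding brings a shorter
  decomposition to length r, where the determinant formula for minors applies.\<close>

lemma tensor_decomposition_pad: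
  assumes v: "tensor_decomposition m n r F v" and "r \<le> r'" and "1 \<le> m" "\<And>t. t \<in> {1..m} \<Longrightarrow> 1 \<le> n t"
  shows "tensor_decomposition m n r' F (\<lambda>s t. if s < r then v s t else 0\<^sub>v (n t))" (is "tensor_decomposition _ _ _ _ ?w")
proof -
  have "(\<Sum>s<r'. \<Prod>t=1..m. ?w s t $ i t) = (\<Sum>s<r. \<Prod>t=1..m. v s t $ i t)"
    if "i \<in> multi_indices m n" for i
  proof -
    have "(\<Sum>s<r'. \<Prod>t=1..m. ?w s t $ i t) = (\<Sum>s<r. \<Prod>t=1..m. ?w s t $ i t)"
    proof (intro sum.mono_neutral_right ballI)
      fix s assume "s \<in> {..<r'} - {..<r}"
      then show "(\<Prod>t=1..m. ?w s t $ i t) = 0"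
        using that \<open>1 \<le> m\<close> by (intro prod_zero bexI[of _ 1]) (auto simp: multi_indices_def PiE_iff)
    qed (use \<open>r \<le> r'\<close> in auto)
    then show ?thesis
      by simp
  qed
  then have "outer_sum m n r' ?w = outer_sum m n r v"
    unfolding outer_sum_def outer_product_def by (intro restrict_ext) auto
  then show ?thesis
    using v unfolding tensor_decomposition_def by auto
qed

section \<open>The algorithm on a decomposition in general position\<close>

text \<open>General position means three things: the block V of the first r entries in mode 1 is
  invertible, with inverse W; the leading entries in the modes from 3 on are nonzero, as the
  algorithm normalizes them to 1; and for each of these modes the vectors of mode products are
  linearly independent.\<close>

locale general_decomposition =
  fixes m r :: nat and n :: "nat \<Rightarrow> nat" and v :: "nat \<Rightarrow> nat \<Rightarrow> complex vec"
    and V W :: "complex mat"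
  assumes m: "3 \<le> m" and r: "r \<le> n 1" and n_pos: "\<And>j. 1 \<le> j \<Longrightarrow> j \<le> m \<Longrightarrow> 1 \<le> n j"
    and v_carrier: "\<And>s t. s < r \<Longrightarrow> 1 \<le> t \<Longrightarrow> t \<le> m \<Longrightarrow> v s t \<in> carrier_vec (n t)"
    and V_def: "V = mat r r (\<lambda>(l, s). v s 1 $ l)"
    and W: "W \<in> carrier_mat r r" and VW: "V * W = 1\<^sub>m r" and WV: "W * V = 1\<^sub>m r"
    and lead: "\<And>s j. s < r \<Longrightarrow> 3 \<le> j \<Longrightarrow> j \<le> m \<Longrightarrow> v s j $ 0 \<noteq> 0"
    and mode_prod_independent:
      "\<And>c s j. 3 \<le> j \<Longrightarrow> j \<le> m \<Longrightarrow> (\<And>\<mu>. \<mu> \<in> row_labels m n j \<Longrightarrow> (\<Sum>s<r. mode_prod m j (v s) \<mu> * c s) = 0)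
        \<Longrightarrow> s < r \<Longrightarrow> c s = 0"
begin

definition F :: "(nat \<Rightarrow> nat) \<Rightarrow> complex" where
  "F = outer_sum m n r v"

definition ratio :: "nat \<Rightarrow> nat \<Rightarrow> nat \<Rightarrow> complex" where
  "ratio j k s = v s j $ k / v s j $ 0"

section \<open>Step 1 and its solutions\<close>

lemma V_carrier: "V \<in> carrier_mat r r"
  unfolding V_def by simp

lemma V_index: "l < r \<Longrightarrow> s < r \<Longrightarrow> V $$ (l, s) = v s 1 $ l"
  unfolding V_def by simp

text \<open>Both sides of the equation are combinations of the same mode products. Independence
  equates their coefficients, and cancelling the nonzero leading entries leaves Y V = V \<Lambda>,
  with \<Lambda> the diagonal matrix of the ratios: the columns of V are eigenvectors of Y.\<close>

lemma step1_equation_iff: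
  assumes jk: "(j, k) \<in> Upsilon m n" and Y: "Y \<in> carrier_mat r r"
  shows "(\<forall>\<mu>\<in>row_labels m n j. \<forall>l<r.
      (\<Sum>l'<r. A_entry F j \<mu> l' * Y\<^sup>T $$ (l', l)) = b_entry F j k \<mu> l) \<longleftrightarrow>
    Y * V = V * diag_of r (ratio j k)" (is "?L \<longleftrightarrow> ?R")
proof -
  have j: "3 \<le> j" "j \<le> m" "k < n j"
    using jk by (auto simp: Upsilon_def)
  have Vd: "V * diag_of r (ratio j k) \<in> carrier_mat r r"
    by (rule mult_carrier_mat[OF V_carrier diag_of_carrier])
  let ?\<Delta> = "\<lambda>l s. v s j $ 0 * ((Y * V) $$ (l, s) - (V * diag_of r (ratio j k)) $$ (l, s))"
  have A: "(\<Sum>l'<r. A_entry F j \<mu> l' * Y\<^sup>T $$ (l', l))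
      = (\<Sum>s<r. mode_prod m j (v s) \<mu> * (v s j $ 0 * (Y * V) $$ (l, s)))"
    if "\<mu> \<in> row_labels m n j" "l < r" for \<mu> l
  proof -
    have "(\<Sum>l'<r. A_entry F j \<mu> l' * Y\<^sup>T $$ (l', l)) =
        (\<Sum>l'<r. \<Sum>s<r. mode_prod m j (v s) \<mu> * v s j $ 0 * (Y $$ (l, l') * v s 1 $ l'))"
      using that j r n_pos[of j] Y
      by (intro sum.cong)
        (simp_all add: A_entry_def F_def outer_sum_update sum_distrib_left mult_ac del: One_nat_def)
    also have "\<dots> = (\<Sum>s<r. \<Sum>l'<r. mode_prod m j (v s) \<mu> * v s j $ 0 * (Y $$ (l, l') * v s 1 $ l'))"
      by (rule sum.swap)
    also have "\<dots> = (\<Sum>s<r. mode_prod m j (v s) \<mu> * (v s j $ 0 * (Y * V) $$ (l, s)))"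
      using that by (intro sum.cong)
        (simp_all add: mult_mat_index[OF Y V_carrier] V_index sum_distrib_left mult_ac del: index_mult_mat)
    finally show ?thesis .
  qed
  have b: "b_entry F j k \<mu> l
      = (\<Sum>s<r. mode_prod m j (v s) \<mu> * (v s j $ 0 * (V * diag_of r (ratio j k)) $$ (l, s)))"
    if "\<mu> \<in> row_labels m n j" "l < r" for \<mu> l
  proof -
    have "b_entry F j k \<mu> l = (\<Sum>s<r. mode_prod m j (v s) \<mu> * v s j $ k * v s 1 $ l)"
      using that j r by (simp add: b_entry_def F_def outer_sum_update del: One_nat_def)
    also have "\<dots> = (\<Sum>s<r. mode_prod m j (v s) \<mu> * (v s j $ 0 * (V * diag_of r (ratio j k)) $$ (l, s)))"
      using that j lead
      by (intro sum.cong) (simp_all add: mult_diag_of_index[OF V_carrier] V_index ratio_def del: index_mult_mat)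
    finally show ?thesis .
  qed
  show ?thesis
  proof
    assume L: ?L
    have "?\<Delta> l s = 0" if "l < r" "s < r" for l s
    proof (rule mode_prod_independent[OF j(1,2) _ that(2), where c = "?\<Delta> l"])
      fix \<mu> assume "\<mu> \<in> row_labels m n j"
      then show "(\<Sum>s<r. mode_prod m j (v s) \<mu> * ?\<Delta> l s) = 0"
        using L A b that(1) by (simp add: right_diff_distrib sum_subtractf del: index_mult_mat)
    qed
    then have "(Y * V) $$ (l, s) = (V * diag_of r (ratio j k)) $$ (l, s)" if "l < r" "s < r" for l s
      using that \<open>\<And>l s. l < r \<Longrightarrow> s < r \<Longrightarrow> ?\<Delta> l s = 0\<close>[of l s] lead[of s j] j
      by (simp del: index_mult_mat)
    then show ?R
      using Vd Y V_carrier by (intro eq_matI) (auto simp del: index_mult_mat(1))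
  next
    assume ?R
    then show ?L
      using A b by simp
  qed
qed

lemma step1_iff:
  "step1 m n r F Y \<longleftrightarrow> (\<forall>(j, k)\<in>Upsilon m n. Y j k \<in> carrier_mat r r \<and>
     Y j k * V = V * diag_of r (ratio j k))"
  unfolding step1_def using step1_equation_iff by blast

lemma step1_solvable: "step1 m n r F (\<lambda>j k. V * diag_of r (ratio j k) * W)"
proof -
  have "V * diag_of r d * W * V = V * diag_of r d" for d
  proof -
    have "V * diag_of r d \<in> carrier_mat r r"
      by (rule mult_carrier_mat[OF V_carrier diag_of_carrier])
    then show ?thesis
      using assoc_mult_mat[of "V * diag_of r d" r r W r V r] W V_carrier right_mult_one_mat[of "V * diag_of r d" r r]
      by (simp only: WV)
  qed
  moreover have "V * diag_of r d * W \<in> carrier_mat r r" for d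
    by (rule mult_carrier_mat[OF mult_carrier_mat[OF V_carrier diag_of_carrier] W])
  ultimately show ?thesis
    unfolding step1_iff by auto
qed

text \<open>Inserting V W = 1 turns the conjugation of Z by P into that of a diagonal matrix by W P,
  whose inverse is Q V when Q inverts P. This is the setting of
  \<open>diagonalizing_distinct_diagonal\<close>.\<close>

lemma conjugate_eq:
  assumes Z: "Z \<in> carrier_mat r r" "Z * V = V * diag_of r z"
    and P: "P \<in> carrier_mat r r" and Q: "Q \<in> carrier_mat r r"
  shows "Q * Z * P = Q * V * diag_of r z * (W * P)"
proof -
  have "Q * Z * P = Q * (Z * ((V * W) * P))"
    unfolding VW using P Q Z(1) by (simp add: assoc_mult_mat[of Q r r Z r P r])
  also have "\<dots> = Q * ((Z * V) * (W * P))"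
    using P Z(1) V_carrier W
    by (simp add: assoc_mult_mat[of _ r r _ r _ r] mult_carrier_mat[of _ r r _ r])
  also have "\<dots> = Q * V * diag_of r z * (W * P)"
    unfolding Z(2) using P Q V_carrier W diag_of_carrier[of r z]
    by (simp add: assoc_mult_mat[of _ r r _ r _ r] mult_carrier_mat[of _ r r _ r])
  finally show ?thesis .
qed

section \<open>Step 2: eigenvectors of the averaged matrix\<close>

definition weight :: "(nat \<times> nat \<Rightarrow> complex) \<Rightarrow> nat \<Rightarrow> complex" where
  "weight \<xi> s = (\<Sum>(j, k)\<in>Upsilon m n. \<xi> (j, k) * ratio j k s)"

lemma averaged_mat_carrier: "averaged_mat m n r \<xi> Y \<in> carrier_mat r r"
  unfolding averaged_mat_def by simp

lemma averaged_mat_index: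
  "a < r \<Longrightarrow> b < r \<Longrightarrow> averaged_mat m n r \<xi> Y $$ (a, b)
    = 1 / (\<Sum>jk\<in>Upsilon m n. \<xi> jk) * (\<Sum>(j, k)\<in>Upsilon m n. \<xi> (j, k) * Y j k $$ (a, b))"
  unfolding averaged_mat_def by simp

text \<open>The columns of V are common eigenvectors of all the Y j k, hence of every linear
  combination; the eigenvalues are the weights up to normalization. If the \<xi> sum to zero, both
  sides are zero because 1 / 0 = 0.\<close>

lemma averaged_mat_mult:
  assumes Y: "step1 m n r F Y"
  shows "averaged_mat m n r \<xi> Y * V
    = V * diag_of r (\<lambda>s. 1 / (\<Sum>jk\<in>Upsilon m n. \<xi> jk) * weight \<xi> s)"
proof (rule eq_matI)
  let ?c = "1 / (\<Sum>jk\<in>Upsilon m n. \<xi> jk)"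
  fix a s assume "a < dim_row (V * diag_of r (\<lambda>s. ?c * weight \<xi> s))"
    "s < dim_col (V * diag_of r (\<lambda>s. ?c * weight \<xi> s))"
  then have as: "a < r" "s < r"
    using V_carrier by (auto simp: diag_of_def)
  have YV: "(\<Sum>b<r. Y j k $$ (a, b) * V $$ (b, s)) = V $$ (a, s) * ratio j k s"
    if "(j, k) \<in> Upsilon m n" for j k
    using Y that mult_mat_index[OF _ V_carrier as, of "Y j k"] mult_diag_of_index[OF V_carrier as]
    unfolding step1_iff by auto
  have "(averaged_mat m n r \<xi> Y * V) $$ (a, s)
      = (\<Sum>b<r. \<Sum>(j, k)\<in>Upsilon m n. ?c * \<xi> (j, k) * (Y j k $$ (a, b) * V $$ (b, s)))"
    unfolding mult_mat_index[OF averaged_mat_carrier V_carrier as]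
    using as by (intro sum.cong)
      (simp_all add: averaged_mat_index sum_distrib_left sum_distrib_right mult_ac case_prod_unfold)
  also have "\<dots> = (\<Sum>(j, k)\<in>Upsilon m n. \<Sum>b<r. ?c * \<xi> (j, k) * (Y j k $$ (a, b) * V $$ (b, s)))"
    unfolding case_prod_unfold by (rule sum.swap)
  also have "\<dots> = (\<Sum>(j, k)\<in>Upsilon m n. ?c * \<xi> (j, k) * (V $$ (a, s) * ratio j k s))"
    unfolding case_prod_unfold
    by (intro sum.cong refl) (simp only: prod.collapse YV flip: sum_distrib_left)
  also have "\<dots> = V $$ (a, s) * (?c * weight \<xi> s)"
    by (simp add: weight_def sum_distrib_left case_prod_unfold mult_ac)
  also have "\<dots> = (V * diag_of r (\<lambda>s. ?c * weight \<xi> s)) $$ (a, s)"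
    using mult_diag_of_index[OF V_carrier as] by simp
  finally show "(averaged_mat m n r \<xi> Y * V) $$ (a, s)
      = (V * diag_of r (\<lambda>s. ?c * weight \<xi> s)) $$ (a, s)" .
qed (use V_carrier in \<open>auto simp: averaged_mat_def diag_of_def\<close>)

lemma step2_solvable:
  assumes Y: "step1 m n r F Y"
  shows "step2 m n r \<xi> Y V W"
proof -
  have "W * averaged_mat m n r \<xi> Y * V
      = W * (V * diag_of r (\<lambda>s. 1 / (\<Sum>jk\<in>Upsilon m n. \<xi> jk) * weight \<xi> s))"
    using averaged_mat_mult[OF Y] assoc_mult_mat[OF W averaged_mat_carrier V_carrier] by simp
  also have "\<dots> = diag_of r (\<lambda>s. 1 / (\<Sum>jk\<in>Upsilon m n. \<xi> jk) * weight \<xi> s)"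
    using assoc_mult_mat[OF W V_carrier diag_of_carrier, symmetric] WV
    by (simp add: left_mult_one_mat[OF diag_of_carrier])
  finally show ?thesis
    using VW WV W V_carrier unfolding step2_def inverts_mat_def
    by (auto simp: diagonal_mat_def diag_of_def)
qed

text \<open>Distinct weights force W P to be monomial, so P = V (W P) consists of permuted and
  scaled columns of V. The same conjugation makes all the Y j k diagonal, with the ratios permuted
  in the same way.\<close>

lemma step2_monomial:
  assumes Y: "step1 m n r F Y" and PQ: "step2 m n r \<xi> Y P Q"
    and \<xi>: "(\<Sum>jk\<in>Upsilon m n. \<xi> jk) \<noteq> 0" "inj_on (weight \<xi>) {..<r}"
  obtains \<pi> \<rho> where "bij_betw \<pi> {..<r} {..<r}" "\<And>b. b < r \<Longrightarrow> \<rho> b \<noteq> 0"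
    "\<And>l b. l < r \<Longrightarrow> b < r \<Longrightarrow> P $$ (l, b) = \<rho> b * v (\<pi> b) 1 $ l"
    "\<And>j k. (j, k) \<in> Upsilon m n \<Longrightarrow> Q * Y j k * P = diag_of r (\<lambda>b. ratio j k (\<pi> b))"
proof -
  have P: "P \<in> carrier_mat r r" and Q: "Q \<in> carrier_mat r r" and "P * Q = 1\<^sub>m r" "Q * P = 1\<^sub>m r"
    and D: "diagonal_mat (Q * averaged_mat m n r \<xi> Y * P)"
    using PQ unfolding step2_def inverts_mat_def by auto
  note [simp] = mult_carrier_mat[of _ r r _ r]
  have R: "W * P \<in> carrier_mat r r" and S: "Q * V \<in> carrier_mat r r"
    using P Q V_carrier W by auto
  have "Q * V * (W * P) = Q * ((V * W) * P)"
    using P Q V_carrier W by (simp add: assoc_mult_mat[of _ r r _ r _ r])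
  then have SR: "Q * V * (W * P) = 1\<^sub>m r"
    using VW P \<open>Q * P = 1\<^sub>m r\<close> by simp
  have "W * P * (Q * V) = W * ((P * Q) * V)"
    using P Q V_carrier W by (simp add: assoc_mult_mat[of _ r r _ r _ r])
  then have RS: "W * P * (Q * V) = 1\<^sub>m r"
    using WV V_carrier \<open>P * Q = 1\<^sub>m r\<close> by simp
  have inj: "inj_on (\<lambda>s. 1 / (\<Sum>jk\<in>Upsilon m n. \<xi> jk) * weight \<xi> s) {..<r}"
    using \<xi> by (auto simp: inj_on_def)
  have diag: "diagonal_mat (Q * V * diag_of r (\<lambda>s. 1 / (\<Sum>jk\<in>Upsilon m n. \<xi> jk) * weight \<xi> s) * (W * P))"
    using D conjugate_eq[OF averaged_mat_carrier averaged_mat_mult[OF Y] P Q] by simp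
  obtain \<pi> \<rho> where *: "bij_betw \<pi> {..<r} {..<r}" "\<And>b. b < r \<Longrightarrow> \<rho> b \<noteq> 0"
    "\<And>a b. a < r \<Longrightarrow> b < r \<Longrightarrow> (W * P) $$ (a, b) = (if a = \<pi> b then \<rho> b else 0)"
    "\<And>z. Q * V * diag_of r z * (W * P) = diag_of r (\<lambda>b. z (\<pi> b))"
    by (rule diagonalizing_distinct_diagonal[OF R S SR RS inj diag], rule that)
  have P_eq: "P $$ (l, b) = \<rho> b * v (\<pi> b) 1 $ l" if "l < r" "b < r" for l b
  proof -
    have \<pi>b: "\<pi> b < r"
      using *(1) that(2) by (auto simp: bij_betw_def)
    have "P = V * (W * P)"
      using VW P assoc_mult_mat[OF V_carrier W P] by simp
    then have "P $$ (l, b) = (\<Sum>a<r. V $$ (l, a) * (W * P) $$ (a, b))"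
      using mult_mat_index[OF V_carrier R that] by simp
    also have "\<dots> = (\<Sum>a<r. if a = \<pi> b then V $$ (l, a) * \<rho> b else 0)"
      using *(3) that by (intro sum.cong) auto
    also have "\<dots> = \<rho> b * v (\<pi> b) 1 $ l"
      using \<pi>b that V_index by simp
    finally show ?thesis .
  qed
  have QYP: "Q * Y j k * P = diag_of r (\<lambda>b. ratio j k (\<pi> b))" if "(j, k) \<in> Upsilon m n" for j k
    using conjugate_eq[OF _ _ P Q] Y that *(4) unfolding step1_iff by auto
  show thesis
    by (rule that[OF *(1,2) P_eq QYP])
qed


section \<open>Steps 3 to 6: recovering the factors\<close>

lemma step3_vec_eq:
  assumes "\<And>j k. (j, k) \<in> Upsilon m n \<Longrightarrow> Q * Y j k * P = diag_of r (\<lambda>b. ratio j k (\<pi> b))"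
    and "s < r" "\<pi> s < r" "3 \<le> j" "j \<le> m" "k < n j"
  shows "step3_vec n Y P Q s j $ k = v (\<pi> s) j $ k / v (\<pi> s) j $ 0"
proof (cases "k = 0")
  \<comment> \<open>The entry 1 set by the algorithm is the quotient of the leading entry by
    itself.\<close>
  case True
  then show ?thesis
    using assms lead[of "\<pi> s" j] by (simp add: step3_vec_def)
next
  case False
  then have "(j, k) \<in> Upsilon m n"
    using assms by (auto simp: Upsilon_def)
  then show ?thesis
    using assms False by (simp add: step3_vec_def diag_of_def ratio_def del: index_mult_mat)
qed

lemma F_entry:
  assumes "i \<in> multi_indices m n"
  shows "F i = (\<Sum>s<r. v s 1 $ i 1 * (v s 2 $ i 2 * (\<Prod>t=3..m. v s t $ i t)))"
proof -
  have "factors (\<lambda>s. v s 1) (\<lambda>s. v s 2) v s t = v s t" for s t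
    by (simp add: factors_def)
  then have "(\<Prod>t=1..m. v s t $ i t) = v s 1 $ i 1 * (v s 2 $ i 2 * (\<Prod>t=3..m. v s t $ i t))" for s
    using prod_factors[OF m, of "\<lambda>s. v s 1" "\<lambda>s. v s 2" v s i] by simp
  then show ?thesis
    using assms unfolding F_def outer_sum_entry[OF assms] by (simp del: One_nat_def)
qed

text \<open>The vectors computed in step 3 are the given ones divided by their leading entries, and
  the columns of P are the given ones times \<rho>. The solution of step 4 is unique and absorbs
  these scalars, so the later steps can be carried out whatever was chosen before.\<close>

lemma algorithm_succeeds_if_weights_distinct:
  assumes \<xi>: "(\<Sum>jk\<in>Upsilon m n. \<xi> jk) \<noteq> 0" "inj_on (weight \<xi>) {..<r}"
  shows "algorithm_succeeds m n r F \<xi>"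
proof -
  have main: "step3 m n Y P Q \<and>
      (let v = step3_vec n Y P Q in
        (\<exists>y. step4 m n r F P v y) \<and>
        (\<forall>y. step4 m n r F P v y \<longrightarrow>
           (\<exists>z. step5 m n r F y v z) \<and>
           (\<forall>z. step5 m n r F y v z \<longrightarrow> tensor_decomposition m n r F (algorithm_output P z y v))))"
    if Y: "step1 m n r F Y" and PQ: "step2 m n r \<xi> Y P Q" for Y P Q
  proof -
    define w where "w = step3_vec n Y P Q"
    obtain \<pi> \<rho> where \<pi>: "bij_betw \<pi> {..<r} {..<r}" and \<rho>: "\<And>b. b < r \<Longrightarrow> \<rho> b \<noteq> 0"
      and P_eq: "\<And>l b. l < r \<Longrightarrow> b < r \<Longrightarrow> P $$ (l, b) = \<rho> b * v (\<pi> b) 1 $ l"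
      and QYP: "\<And>j k. (j, k) \<in> Upsilon m n \<Longrightarrow> Q * Y j k * P = diag_of r (\<lambda>b. ratio j k (\<pi> b))"
      by (rule step2_monomial[OF Y PQ \<xi>], rule that)
    have P: "P \<in> carrier_mat r r" and Q: "Q \<in> carrier_mat r r" and QP: "Q * P = 1\<^sub>m r"
      using PQ unfolding step2_def inverts_mat_def by auto
    have \<pi>_less: "\<pi> s < r" if "s < r" for s
      using \<pi> that by (auto simp: bij_betw_def)
    \<comment> \<open>The total scalar lost when the vectors of modes 3 to m are normalized.\<close>
    define L where "L s = (\<Prod>t=3..m. v s t $ 0)" for s
    have L: "L s \<noteq> 0" if "s < r" for s
      using that lead unfolding L_def by auto
    have w_prod: "(\<Prod>t=3..m. w s t $ i t) = (\<Prod>t=3..m. v (\<pi> s) t $ i t) / L (\<pi> s)"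
      if "s < r" "\<And>t. 3 \<le> t \<Longrightarrow> t \<le> m \<Longrightarrow> i t < n t" for s i
      using that \<pi>_less unfolding w_def L_def
      by (simp add: step3_vec_eq[OF QYP] flip: prod_dividef)
    \<comment> \<open>Mode 2 makes up for the normalization in the later modes and for the scaling
      of the columns of P. In \<open>z0\<close> the columns of P are continued below row r with the
      same scaling.\<close>
    define y0 where "y0 s = (L (\<pi> s) / \<rho> s) \<cdot>\<^sub>v v (\<pi> s) 2" for s
    define z0 where "z0 s = vec (n 1 - r) (\<lambda>l. \<rho> s * v (\<pi> s) 1 $ (r + l))" for s
    have v2: "v s 2 \<in> carrier_vec (n 2)" if "s < r" for s
      using v_carrier[OF that, of 2] m by simp
    have y0_carrier: "y0 s \<in> carrier_vec (n 2)" if "s < r" for s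
      using v2[OF \<pi>_less[OF that]] by (simp add: y0_def)
    have term_eq: "x * (y0 s $ i 2 * (\<Prod>t=3..m. w s t $ i t))
        = v (\<pi> s) 1 $ l * (v (\<pi> s) 2 $ i 2 * (\<Prod>t=3..m. v (\<pi> s) t $ i t))"
      if "s < r" "x = \<rho> s * v (\<pi> s) 1 $ l" "\<And>t. 2 \<le> t \<Longrightarrow> t \<le> m \<Longrightarrow> i t < n t" for x s i l
    proof -
      have "i 2 < dim_vec (v (\<pi> s) 2)"
        using that(3)[of 2] m v2[OF \<pi>_less[OF that(1)]] by auto
      then have "y0 s $ i 2 = L (\<pi> s) / \<rho> s * v (\<pi> s) 2 $ i 2"
        by (simp add: y0_def)
      moreover have "(\<Prod>t=3..m. w s t $ i t) = (\<Prod>t=3..m. v (\<pi> s) t $ i t) / L (\<pi> s)"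
        using that by (intro w_prod) auto
      ultimately show ?thesis
        using that(2) \<rho>[OF that(1)] L[OF \<pi>_less[OF that(1)]] by simp
    qed
    \<comment> \<open>The first index l is kept apart from i, so that the identity serves both
      blocks of F along mode 1: l = i 1 in step 4 and l = r + i 1 in step 5.\<close>
    have sum_eq: "(\<Sum>s<r. x s * (y0 s $ i 2 * (\<Prod>t=3..m. w s t $ i t))) = F (i(1 := l))"
      if x: "\<And>s. s < r \<Longrightarrow> x s = \<rho> s * v (\<pi> s) 1 $ l"
        and i: "i(1 := l) \<in> multi_indices m n" for x i l
    proof -
      have i_less: "i t < n t" if "2 \<le> t" "t \<le> m" for t
        using PiE_mem[OF i[unfolded multi_indices_def], of t] that by auto
      have "(\<Sum>s<r. x s * (y0 s $ i 2 * (\<Prod>t=3..m. w s t $ i t)))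
          = (\<Sum>s<r. v (\<pi> s) 1 $ l * (v (\<pi> s) 2 $ i 2 * (\<Prod>t=3..m. v (\<pi> s) t $ i t)))"
        using i_less x by (intro sum.cong term_eq) auto
      also have "\<dots> = (\<Sum>s<r. v s 1 $ l * (v s 2 $ i 2 * (\<Prod>t=3..m. v s t $ i t)))"
        using sum.reindex_bij_betw[OF \<pi>, of "\<lambda>s. v s 1 $ l * (v s 2 $ i 2 * (\<Prod>t=3..m. v s t $ i t))"] .
      also have "\<dots> = F (i(1 := l))"
        unfolding F_entry[OF i] by (intro sum.cong arg_cong2[of _ _ _ _ "(*)"] prod.cong refl) auto
      finally show ?thesis .
    qed
    have step3: "step3 m n Y P Q"
    proof -
      have "diagonal_mat (diag_of r d)" for d :: "nat \<Rightarrow> complex"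
        by (simp add: diagonal_mat_def diag_of_def)
      then show ?thesis
        unfolding step3_def using QYP by auto
    qed
    have shift: "i(1 := a + i 1) \<in> multi_indices m n"
      if "i \<in> multi_indices m (n(1 := b - a))" "b \<le> n 1" for i a b
      using that m unfolding multi_indices_def by (auto simp: PiE_iff extensional_def split: if_splits)
    have step4_y0: "step4 m n r F P w y0"
    proof -
      have "F (i(1 := 0 + i 1)) = outer_sum m (n(1 := r)) r (factors (col P) y0 w) i"
        if i: "i \<in> multi_indices m (n(1 := r))" for i
      proof -
        have "i 1 < r"
          using PiE_mem[OF i[unfolded multi_indices_def], of 1] m by auto
        then have "col P s $ i 1 = \<rho> s * v (\<pi> s) 1 $ (0 + i 1)" if "s < r" for s
          using P P_eq that by simp
        then show ?thesis
          unfolding outer_sum_entry[OF i] prod_factors[OF m]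
          using shift[of i r 0] i r by (intro sum_eq[symmetric]) auto
      qed
      then show ?thesis
        unfolding step4_def subtensor_def using y0_carrier
        by (auto simp: outer_sum_def intro!: restrict_ext)
    qed
    have step4_unique: "y s = y0 s" if y: "step4 m n r F P w y" and s: "s < r" for y s
    proof -
      have "y s $ k = y0 s $ k" if k: "k < n 2" for k
      proof -
        have "(\<Sum>s<r. P $$ (l, s) * (y s $ k - y0 s $ k)) = 0" if l: "l < r" for l
        proof -
          \<comment> \<open>At index 0 in the modes from 3 on, all normalized vectors have entry 1.
            There step 4 is a linear system with matrix P, which is invertible, so it determines the
            entries of the y s.\<close>
          define i where "i = (\<lambda>t\<in>{1..m}. if t = 1 then l else if t = 2 then k else 0)"
          have i: "i \<in> multi_indices m (n(1 := r))"
            using l k n_pos unfolding i_def multi_indices_def by (auto simp: Suc_le_eq)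
          have i12: "i 1 = l" "i 2 = k"
            using m by (auto simp: i_def)
          have "(\<Prod>t=3..m. w s t $ i t) = 1" if "s < r" for s
            using n_pos by (intro prod.neutral) (auto simp: i_def w_def step3_vec_def Suc_le_eq)
          then have "outer_sum m (n(1 := r)) r (factors (col P) y' w) i = (\<Sum>s<r. P $$ (l, s) * y' s $ k)"
            for y'
            unfolding outer_sum_entry[OF i] prod_factors[OF m] i12
            using P l by (intro sum.cong) auto
          moreover have "outer_sum m (n(1 := r)) r (factors (col P) y w)
              = outer_sum m (n(1 := r)) r (factors (col P) y0 w)"
            using y step4_y0 unfolding step4_def by simp
          ultimately have "(\<Sum>s<r. P $$ (l, s) * y s $ k) = (\<Sum>s<r. P $$ (l, s) * y0 s $ k)"
            by metis
          then show ?thesis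
            by (simp add: right_diff_distrib sum_subtractf)
        qed
        moreover have "det P \<noteq> 0"
          using det_mult[OF Q P] QP by auto
        ultimately have "y s $ k - y0 s $ k = 0"
          using sum_mult_eq_0_imp_eq_0[OF P, where c = "\<lambda>s. y s $ k - y0 s $ k"] s by blast
        then show ?thesis
          by simp
      qed
      moreover have "y s \<in> carrier_vec (n 2)" "y0 s \<in> carrier_vec (n 2)"
        using y y0_carrier s unfolding step4_def by auto
      ultimately show ?thesis
        by (intro eq_vecI) auto
    qed
    \<comment> \<open>Every solution y of step 4 agrees with y0 for s < r, so \<open>z0\<close>
      works for all of them.\<close>
    have step5: "step5 m n r F y w z0" if y: "step4 m n r F P w y" for y
    proof -
      have "F (i(1 := r + i 1)) = outer_sum m (n(1 := n 1 - r)) r (factors z0 y w) i"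
        if i: "i \<in> multi_indices m (n(1 := n 1 - r))" for i
      proof -
        have "i 1 < n 1 - r"
          using PiE_mem[OF i[unfolded multi_indices_def], of 1] m by auto
        then have z0: "z0 s $ i 1 = \<rho> s * v (\<pi> s) 1 $ (r + i 1)" for s
          by (simp add: z0_def)
        have "(\<Sum>s<r. z0 s $ i 1 * (y s $ i 2 * (\<Prod>t=3..m. w s t $ i t)))
            = (\<Sum>s<r. z0 s $ i 1 * (y0 s $ i 2 * (\<Prod>t=3..m. w s t $ i t)))"
          using step4_unique[OF y] by (intro sum.cong) auto
        also have "\<dots> = F (i(1 := r + i 1))"
          using shift[OF i] z0 by (intro sum_eq) auto
        finally show ?thesis
          unfolding outer_sum_entry[OF i] prod_factors[OF m] by simp
      qed
      then show ?thesis
        unfolding step5_def subtensor_def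
        by (auto simp: outer_sum_def z0_def intro!: restrict_ext)
    qed
    have decomposition: "tensor_decomposition m n r F (algorithm_output P z y w)"
      if y: "step4 m n r F P w y" and z: "step5 m n r F y w z" for y z
    proof -
      have z_carrier: "z s \<in> carrier_vec (n 1 - r)" if "s < r" for s
        using z that unfolding step5_def by simp
      \<comment> \<open>Any solution z will do here: the equations of steps 4 and 5 are the entries
        of F with first index below r and from r on, and gluing the blocks gives F.\<close>
      have "F i = outer_sum m n r (algorithm_output P z y w) i" if i: "i \<in> multi_indices m n" for i
      proof (cases "i 1 < r")
        case True
        then have i': "i \<in> multi_indices m (n(1 := r))"
          using i unfolding multi_indices_def by (auto simp: PiE_iff)
        have "F i = subtensor m n 0 r F i"
          using i' by (simp add: subtensor_def)
        also have "\<dots> = outer_sum m (n(1 := r)) r (factors (col P) y w) i"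
          using y unfolding step4_def by simp
        also have "\<dots> = outer_sum m n r (algorithm_output P z y w) i"
          unfolding outer_sum_entry[OF i'] outer_sum_entry[OF i] algorithm_output_def prod_factors[OF m]
          using True P z_carrier by (intro sum.cong) auto
        finally show ?thesis .
      next
        case False
        define i' where "i' = i(1 := i 1 - r)"
        have "i 1 < n 1"
          using PiE_mem[OF i[unfolded multi_indices_def], of 1] m by auto
        moreover from this have "i 1 - r < n 1 - r"
          using False by linarith
        ultimately have i': "i' \<in> multi_indices m (n(1 := n 1 - r))"
          using i False m unfolding multi_indices_def i'_def
          by (auto simp: PiE_iff extensional_def)
        have "i'(1 := r + i' 1) = i"
          using False by (simp add: i'_def)
        then have "F i = subtensor m n r (n 1) F i'"
          unfolding subtensor_def restrict_apply'[OF i'] by simp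
        also have "\<dots> = outer_sum m (n(1 := n 1 - r)) r (factors z y w) i'"
          using z unfolding step5_def by simp
        also have "\<dots> = outer_sum m n r (algorithm_output P z y w) i"
          unfolding outer_sum_entry[OF i'] outer_sum_entry[OF i] algorithm_output_def prod_factors[OF m]
        proof (rule sum.cong)
          fix s assume "s \<in> {..<r}"
          have "z s $ i' 1 = (col P s @\<^sub>v z s) $ i 1"
            using False P z_carrier[of s] \<open>s \<in> {..<r}\<close> r \<open>i 1 < n 1\<close> by (auto simp: i'_def)
          moreover have "(\<Prod>t=3..m. w s t $ i' t) = (\<Prod>t=3..m. w s t $ i t)"
            by (intro prod.cong) (auto simp: i'_def)
          moreover have "i' 2 = i 2"
            by (simp add: i'_def)
          ultimately show "z s $ i' 1 * (y s $ i' 2 * (\<Prod>t=3..m. w s t $ i' t))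
              = (col P s @\<^sub>v z s) $ i 1 * (y s $ i 2 * (\<Prod>t=3..m. w s t $ i t))"
            by simp
        qed simp
        finally show ?thesis .
      qed
      moreover have "F \<in> extensional (multi_indices m n)"
        unfolding F_def outer_sum_def by simp
      ultimately have "F = outer_sum m n r (algorithm_output P z y w)"
        by (intro extensionalityI[of _ "multi_indices m n"]) (auto simp: outer_sum_def)
      moreover have "algorithm_output P z y w s t \<in> carrier_vec (n t)"
        if "s < r" "t \<in> {1..m}" for s t
      proof -
        have "col P s @\<^sub>v z s \<in> carrier_vec (r + (n 1 - r))"
          using that P by (intro append_carrier_vec z_carrier) auto
        then have "col P s @\<^sub>v z s \<in> carrier_vec (n 1)"
          using r by simp
        moreover have "y s \<in> carrier_vec (n 2)"
          using y that unfolding step4_def by blast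
        ultimately show ?thesis
          by (simp add: algorithm_output_def factors_def w_def step3_vec_def)
      qed
      ultimately show ?thesis
        unfolding tensor_decomposition_def by simp
    qed
    show ?thesis
      unfolding Let_def w_def[symmetric]
      by (rule conjI[OF step3], rule conjI, rule exI, rule step4_y0, intro allI impI, rule conjI,
          rule exI, rule step5, assumption, intro allI impI, rule decomposition)
  qed
  have step1_ex: "\<exists>Y. step1 m n r F Y"
    using step1_solvable by blast
  show ?thesis
    unfolding algorithm_succeeds_def
  proof (rule conjI[OF step1_ex], intro allI impI)
    fix Y assume Y: "step1 m n r F Y"
    show "(\<Sum>jk\<in>Upsilon m n. \<xi> jk) \<noteq> 0 \<and> (\<exists>P Q. step2 m n r \<xi> Y P Q) \<and>
      (\<forall>P Q. step2 m n r \<xi> Y P Q \<longrightarrow> step3 m n Y P Q \<and>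
        (let v = step3_vec n Y P Q in
          (\<exists>y. step4 m n r F P v y) \<and>
          (\<forall>y. step4 m n r F P v y \<longrightarrow>
             (\<exists>z. step5 m n r F y v z) \<and>
             (\<forall>z. step5 m n r F y v z \<longrightarrow> tensor_decomposition m n r F (algorithm_output P z y v)))))"
      by (rule conjI[OF \<xi>(1)], rule conjI, rule exI, rule exI, rule step2_solvable[OF Y],
          intro allI impI, rule main[OF Y])
  qed
qed

end


section \<open>Nonvanishing conditions on the tensor\<close>

text \<open>The Krylov matrix of B adj(A), started at A applied to the all-ones vector. The adjugate
  keeps the entries polynomial in A and B.\<close>

definition krylov_mat :: "nat \<Rightarrow> complex mat \<Rightarrow> complex mat \<Rightarrow> complex mat" where
  "krylov_mat r A B =
     mat r r (\<lambda>(i, c). ((B * adj_mat A) ^\<^sub>m c * (A * mat r 1 (\<lambda>_. 1))) $$ (i, 0))"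

lemma polynomial_maps_det_krylov_mat:
  assumes "A \<in> polynomial_mats I r r" "B \<in> polynomial_mats I r r"
  shows "(\<lambda>x. det (krylov_mat r (A x) (B x))) \<in> polynomial_maps I"
proof -
  have one: "(\<lambda>x. mat r 1 (\<lambda>_. 1)) \<in> polynomial_mats I r 1"
    unfolding polynomial_mats_def by (auto intro: polynomial_maps.const)
  have "(\<lambda>x. (B x * adj_mat (A x)) ^\<^sub>m c * (A x * mat r 1 (\<lambda>_. 1))) \<in> polynomial_mats I r 1" for c
    by (intro polynomial_mats_mult[OF polynomial_mats_power[OF polynomial_mats_mult[OF assms(2)
          polynomial_mats_adj_mat[OF assms(1)]]] polynomial_mats_mult[OF assms(1) one]])
  then show ?thesis
    unfolding krylov_mat_def
    by (intro polynomial_maps_det[where a = r] polynomial_mats_mat polynomial_mats_entry[where b = 1]) auto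
qed

text \<open>From A adj(A) = det(A) 1 and A = K C it follows that C adj(A) K = det(A) 1, so M = B
  adj(A) satisfies M K = K diag(z det(A)). Column c of the Krylov matrix is therefore K diag((z
  det(A)) ^ c) applied to the row sums of C.\<close>

lemma krylov_mat_eq:
  assumes K: "K \<in> carrier_mat r r" and C: "C \<in> carrier_mat r r" and "det K \<noteq> 0"
    and A: "A = K * C" and B: "B = K * diag_of r z * C"
  shows "krylov_mat r A B =
    K * (diag_of r (\<lambda>s. \<Sum>l<r. C $$ (s, l)) * mat r r (\<lambda>(s, c). (z s * det A) ^ c))"
proof -
  obtain K' where K': "K' \<in> carrier_mat r r" "K' * K = 1\<^sub>m r"
    using mult_mat_inverse_exists[OF K \<open>det K \<noteq> 0\<close>] by blast
  have Ac: "A \<in> carrier_mat r r"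
    unfolding A using K C by simp
  note adj = adj_mat(1,2)[OF Ac]
  have KD: "K * diag_of r d \<in> carrier_mat r r" for d
    by (rule mult_carrier_mat[OF K diag_of_carrier])
  \<comment> \<open>Prefixing K' K completes C to A, which meets its adjugate.\<close>
  have "C * (adj_mat A * K) = (K' * K) * (C * (adj_mat A * K))"
    using K' K C adj(1) by (simp add: left_mult_one_mat[OF mult_carrier_mat])
  also have "\<dots> = K' * ((A * adj_mat A) * K)"
    unfolding A using K'(1) K C adj(1)
    by (simp add: A assoc_mult_mat[of _ r r _ r _ r] mult_carrier_mat[of _ r r _ r])
  also have "\<dots> = K' * (det A \<cdot>\<^sub>m K)"
    unfolding adj(2) using K by (simp add: mult_smult_assoc_mat[OF one_carrier_mat K])
  also have "\<dots> = det A \<cdot>\<^sub>m 1\<^sub>m r"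
    using K' by (simp add: mult_smult_distrib[OF K'(1) K])
  also have "\<dots> = diag_of r (\<lambda>_. det A)"
    by (rule eq_matI) (auto simp: diag_of_def)
  finally have CaK: "C * (adj_mat A * K) = diag_of r (\<lambda>_. det A)" .
  define M where "M = B * adj_mat A"
  have M: "M \<in> carrier_mat r r"
    unfolding M_def B using mult_carrier_mat[OF mult_carrier_mat[OF KD C] adj(1)] .
  have "M * K = K * diag_of r z * (C * (adj_mat A * K))"
    unfolding M_def B using C K adj(1) KD[of z]
    by (simp add: assoc_mult_mat[of "K * diag_of r z" r r _ r _ r]
        assoc_mult_mat[of C r r _ r _ r] mult_carrier_mat[of _ r r _ r])
  also have "\<dots> = K * diag_of r (\<lambda>s. z s * det A)"
    unfolding CaK by (simp add: assoc_mult_mat[OF K diag_of_carrier diag_of_carrier] diag_of_mult_diag_of)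
  finally have MK: "M * K = K * diag_of r (\<lambda>s. z s * det A)" .
  have power: "M ^\<^sub>m c * K = K * diag_of r (\<lambda>s. (z s * det A) ^ c)" for c
  proof (induction c)
    case 0
    have "diag_of r (\<lambda>_. 1) = (1\<^sub>m r :: complex mat)"
      by (rule eq_matI) (auto simp: diag_of_def)
    then show ?case
      using M K by simp
  next
    case (Suc c)
    have Mc: "M ^\<^sub>m c \<in> carrier_mat r r"
      using M by simp
    have "M ^\<^sub>m Suc c * K = M ^\<^sub>m c * (M * K)"
      using assoc_mult_mat[OF Mc M K] by simp
    also have "\<dots> = (M ^\<^sub>m c * K) * diag_of r (\<lambda>s. z s * det A)"
      unfolding MK using assoc_mult_mat[OF Mc K diag_of_carrier] by simp
    also have "\<dots> = K * diag_of r (\<lambda>s. (z s * det A) ^ Suc c)"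
      unfolding Suc by (simp add: assoc_mult_mat[OF K diag_of_carrier diag_of_carrier]
          diag_of_mult_diag_of mult_ac)
    finally show ?case .
  qed
  let ?h = "\<lambda>s. \<Sum>l<r. C $$ (s, l)" and ?G = "mat r r (\<lambda>(s, c). (z s * det A) ^ c)"
  have hG: "diag_of r ?h * ?G \<in> carrier_mat r r"
    by (rule mult_carrier_mat[OF diag_of_carrier]) simp
  have one: "mat r 1 (\<lambda>_. 1) \<in> carrier_mat r 1"
    by simp
  have "(M ^\<^sub>m c * (A * mat r 1 (\<lambda>_. 1))) $$ (i, 0) = (K * (diag_of r ?h * ?G)) $$ (i, c)"
    if "i < r" "c < r" for i c
  proof -
    have Mc: "M ^\<^sub>m c \<in> carrier_mat r r"
      using M by simp
    have C1: "C * mat r 1 (\<lambda>_. 1) \<in> carrier_mat r 1"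
      by (rule mult_carrier_mat[OF C one])
    have "M ^\<^sub>m c * (A * mat r 1 (\<lambda>_. 1)) = (M ^\<^sub>m c * K) * (C * mat r 1 (\<lambda>_. 1))"
      unfolding A assoc_mult_mat[OF K C one] assoc_mult_mat[OF Mc K C1] ..
    then have eq: "M ^\<^sub>m c * (A * mat r 1 (\<lambda>_. 1)) =
        K * diag_of r (\<lambda>s. (z s * det A) ^ c) * (C * mat r 1 (\<lambda>_. 1))"
      unfolding power .
    have "(M ^\<^sub>m c * (A * mat r 1 (\<lambda>_. 1))) $$ (i, 0) =
        (\<Sum>s<r. K $$ (i, s) * (z s * det A) ^ c * ?h s)"
      unfolding eq mult_mat_index[OF KD C1 that(1) less_one[THEN iffD2, OF refl]] using that
      by (simp add: mult_diag_of_index[OF K] mult_mat_index[OF C one] del: index_mult_mat One_nat_def)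
    also have "\<dots> = (K * (diag_of r ?h * ?G)) $$ (i, c)"
      unfolding mult_mat_index[OF K hG that]
    proof (rule sum.cong)
      fix s assume "s \<in> {..<r}"
      then show "K $$ (i, s) * (z s * det A) ^ c * ?h s = K $$ (i, s) * (diag_of r ?h * ?G) $$ (s, c)"
        using that diag_of_mult_index[of ?G r r s c ?h] by simp
    qed simp
    finally show ?thesis .
  qed
  then show ?thesis
    unfolding krylov_mat_def M_def[symmetric] using K hG by (intro eq_matI) auto
qed

text \<open>The determinant is the product of det K, the row sums of C and a Vandermonde
  determinant. As det A is nonzero, the nodes z s det(A) are distinct exactly when the z s
  are.\<close>

lemma det_krylov_mat_nonzero_iff:
  assumes K: "K \<in> carrier_mat r r" and C: "C \<in> carrier_mat r r"
    and A: "A = K * C" and B: "B = K * diag_of r z * C" and "det A \<noteq> 0"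
  shows "det (krylov_mat r A B) \<noteq> 0 \<longleftrightarrow> (\<forall>s<r. (\<Sum>l<r. C $$ (s, l)) \<noteq> 0) \<and> inj_on z {..<r}"
proof -
  let ?G = "mat r r (\<lambda>(s, c). (z s * det A) ^ c)"
  have G: "?G \<in> carrier_mat r r"
    by simp
  have "det K \<noteq> 0"
    using \<open>det A \<noteq> 0\<close> det_mult[OF K C] unfolding A by auto
  have "det (krylov_mat r A B) = det K * ((\<Prod>s<r. \<Sum>l<r. C $$ (s, l)) * det ?G)"
    unfolding krylov_mat_eq[OF K C \<open>det K \<noteq> 0\<close> A B] det_mult[OF K mult_carrier_mat[OF diag_of_carrier G]]
      det_mult[OF diag_of_carrier G] det_diag_of ..
  moreover have "inj_on z {..<r}" if "det ?G \<noteq> 0"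
  proof (rule inj_onI, rule ccontr)
    fix s s' assume "s \<in> {..<r}" "s' \<in> {..<r}" "z s = z s'" "s \<noteq> s'"
    then have "det ?G = 0"
      by (intro det_identical_rows[OF G, of s s']) (auto intro!: eq_vecI)
    then show False
      using that by simp
  qed
  moreover have "det ?G \<noteq> 0" if "inj_on z {..<r}"
    using that \<open>det A \<noteq> 0\<close> by (intro det_vandermonde_nonzero) (auto simp: inj_on_def)
  ultimately show ?thesis
    using \<open>det K \<noteq> 0\<close> by auto
qed

section \<open>Minors of slices and a lower bound for the rank\<close>

text \<open>The rows \<open>\<mu> 0, ..., \<mu> (r - 1)\<close> of \<open>b[F, j, k]\<close>, and of \<open>A[F, j]\<close> when \<open>k = 0\<close>.\<close>
definition slice_mat ::
  "nat \<Rightarrow> nat \<Rightarrow> nat \<Rightarrow> (nat \<Rightarrow> nat \<Rightarrow> nat) \<Rightarrow> ((nat \<Rightarrow> nat) \<Rightarrow> complex) \<Rightarrow> complex mat" where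
  "slice_mat r j k \<mu> F = mat r r (\<lambda>(i, l). F ((\<mu> i)(1 := l, j := k)))"

definition mode_prod_mat ::
  "nat \<Rightarrow> nat \<Rightarrow> nat \<Rightarrow> (nat \<Rightarrow> nat \<Rightarrow> complex vec) \<Rightarrow> (nat \<Rightarrow> nat \<Rightarrow> nat) \<Rightarrow> complex mat" where
  "mode_prod_mat m r j v \<mu> = mat r r (\<lambda>(i, s). mode_prod m j (v s) (\<mu> i))"

definition first_mode_mat :: "nat \<Rightarrow> (nat \<Rightarrow> nat \<Rightarrow> complex vec) \<Rightarrow> complex mat" where
  "first_mode_mat r v = mat r r (\<lambda>(l, s). v s 1 $ l)"

lemma mode_prod_mat_carrier: "mode_prod_mat m r j v \<mu> \<in> carrier_mat r r"
  unfolding mode_prod_mat_def by simp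

lemma first_mode_mat_carrier: "first_mode_mat r v \<in> carrier_mat r r"
  unfolding first_mode_mat_def by simp

lemma diag_first_mode_mat_carrier: "diag_of r d * (first_mode_mat r v)\<^sup>T \<in> carrier_mat r r"
  by (rule mult_carrier_mat[OF diag_of_carrier]) (simp add: first_mode_mat_carrier)

lemma polynomial_mats_slice_mat:
  assumes "\<mu> ` {..<r} \<subseteq> row_labels m n j" "r \<le> n 1" "k < n j" "2 \<le> j" "j \<le> m"
  shows "slice_mat r j k \<mu> \<in> polynomial_mats (multi_indices m n) r r"
  unfolding slice_mat_def[abs_def]
  by (intro polynomial_mats_mat polynomial_maps.coord update_in_multi_indices) (use assms in auto)

text \<open>The matrix form of \<open>outer_sum_update\<close> for the selected rows; only the
  diagonal factor depends on k.\<close>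

lemma slice_mat_outer_sum:
  assumes "\<mu> ` {..<r} \<subseteq> row_labels m n j" "r \<le> n 1" "k < n j" "2 \<le> j" "j \<le> m"
  shows "slice_mat r j k \<mu> (outer_sum m n r v) =
    mode_prod_mat m r j v \<mu> * (diag_of r (\<lambda>s. v s j $ k) * (first_mode_mat r v)\<^sup>T)"
    (is "_ = ?M * (?D * ?V)")
proof (rule eq_matI)
  fix i l assume "i < dim_row (?M * (?D * ?V))" "l < dim_col (?M * (?D * ?V))"
  then have il: "i < r" "l < r"
    by (auto simp: mode_prod_mat_def first_mode_mat_def)
  have "(?D * ?V) $$ (s, l) = v s j $ k * v s 1 $ l" if "s < r" for s
    using diag_of_mult_index[of ?V r r s l] that il by (simp add: first_mode_mat_def)
  moreover have "slice_mat r j k \<mu> (outer_sum m n r v) $$ (i, l)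
      = (\<Sum>s<r. mode_prod m j (v s) (\<mu> i) * v s j $ k * v s 1 $ l)"
    using il outer_sum_update[where j = j and k = k and \<mu> = "\<mu> i" and l = l] assms
    by (auto simp: slice_mat_def)
  ultimately show "slice_mat r j k \<mu> (outer_sum m n r v) $$ (i, l) = (?M * (?D * ?V)) $$ (i, l)"
    unfolding mult_mat_index[OF mode_prod_mat_carrier diag_first_mode_mat_carrier il]
    using il by (simp add: mode_prod_mat_def mult.assoc del: index_mult_mat)
qed (auto simp: slice_mat_def mode_prod_mat_def first_mode_mat_def)

lemma det_slice_mat_outer_sum:
  assumes "\<mu> ` {..<r} \<subseteq> row_labels m n j" "r \<le> n 1" "k < n j" "2 \<le> j" "j \<le> m"
  shows "det (slice_mat r j k \<mu> (outer_sum m n r v)) =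
    det (mode_prod_mat m r j v \<mu>) * ((\<Prod>s<r. v s j $ k) * det (first_mode_mat r v))"
proof -
  have V: "(first_mode_mat r v)\<^sup>T \<in> carrier_mat r r"
    by (simp add: first_mode_mat_carrier)
  show ?thesis
    unfolding slice_mat_outer_sum[OF assms] det_mult[OF mode_prod_mat_carrier diag_first_mode_mat_carrier]
      det_mult[OF diag_of_carrier V] det_diag_of det_transpose[OF first_mode_mat_carrier] ..
qed

text \<open>A decomposition with r' < r terms could be padded with zero vectors to r terms. Then the
  diagonal factor of the slice would have a zero at r', and the minor would vanish.\<close>

lemma tensor_rank_eq_if_det_slice_mat_nonzero:
  assumes v: "tensor_decomposition m n r F v" and "1 \<le> m" "\<And>t. t \<in> {1..m} \<Longrightarrow> 1 \<le> n t"
    and \<mu>: "\<mu> ` {..<r} \<subseteq> row_labels m n j" "r \<le> n 1" "k < n j" "2 \<le> j" "j \<le> m"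
    and det: "det (slice_mat r j k \<mu> F) \<noteq> 0"
  shows "tensor_rank m n F = r"
  unfolding tensor_rank_def
proof (rule Least_equality)
  fix r' assume "\<exists>w. tensor_decomposition m n r' F w"
  then obtain w where w: "tensor_decomposition m n r' F w"
    by blast
  show "r \<le> r'"
  proof (rule ccontr)
    assume "\<not> r \<le> r'"
    let ?w = "\<lambda>s t. if s < r' then w s t else 0\<^sub>v (n t)"
    have "tensor_decomposition m n r F ?w"
      using \<open>\<not> r \<le> r'\<close> assms(2,3) by (intro tensor_decomposition_pad[OF w]) auto
    then have "F = outer_sum m n r ?w"
      unfolding tensor_decomposition_def by simp
    then have "(\<Prod>s<r. ?w s j $ k) \<noteq> 0"
      using det det_slice_mat_outer_sum[OF \<mu>, where v = ?w] by auto
    moreover have "(\<Prod>s<r. ?w s j $ k) = 0"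
      using \<open>\<not> r \<le> r'\<close> \<open>k < n j\<close> by (intro prod_zero bexI[of _ r']) auto
    ultimately show False
      by contradiction
  qed
qed (use v in blast)


section \<open>A witness and the genericity theorem\<close>

text \<open>Reduction modulo B compares the lowest digits; cancelling them and the factor B leaves a
  shorter expansion.\<close>

lemma digits_unique:
  fixes B :: nat
  assumes "\<And>t. t < m \<Longrightarrow> a t < B" "\<And>t. t < m \<Longrightarrow> b t < B"
    and "(\<Sum>t<m. B ^ t * a t) = (\<Sum>t<m. B ^ t * b t)" and "t < m"
  shows "a t = b t"
  using assms
proof (induction m arbitrary: a b t)
  case (Suc m)
  have split: "(\<Sum>t<Suc m. B ^ t * c t) = c 0 + B * (\<Sum>t<m. B ^ t * c (Suc t))" for c :: "nat \<Rightarrow> nat"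
    by (simp only: sum.lessThan_Suc_shift) (simp add: sum_distrib_left mult_ac)
  have eq: "a 0 + B * (\<Sum>t<m. B ^ t * a (Suc t)) = b 0 + B * (\<Sum>t<m. B ^ t * b (Suc t))"
    using Suc.prems(3) unfolding split .
  have "a 0 < B" "b 0 < B"
    using Suc.prems(1,2) by auto
  then have "a 0 = b 0"
    using arg_cong[OF eq, of "\<lambda>x. x mod B"] by simp
  moreover have "(\<Sum>t<m. B ^ t * a (Suc t)) = (\<Sum>t<m. B ^ t * b (Suc t))"
    using eq \<open>a 0 = b 0\<close> \<open>a 0 < B\<close> by auto
  then have "a (Suc t) = b (Suc t)" if "t < m" for t
    using Suc.IH[of "\<lambda>t. a (Suc t)" "\<lambda>t. b (Suc t)" t] Suc.prems(1,2) that by auto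
  ultimately show ?case
    using Suc.prems(4) by (cases t) auto
qed simp

lemma inj_on_row_labels:
  assumes "\<And>t. t \<in> {1..m} \<Longrightarrow> n t \<le> B" "0 < B"
  shows "inj_on (\<lambda>\<mu>. \<Sum>t\<in>{1..m} - {1, j}. B ^ t * \<mu> t) (row_labels m n j)"
proof (rule inj_onI)
  let ?T = "{1..m} - {1, j}"
  \<comment> \<open>Positions 0, 1 and j are filled with digit 0, which turns the sum over the
    remaining modes into a full expansion over the positions up to m.\<close>
  let ?d = "\<lambda>\<mu> t. if t \<in> ?T then \<mu> t else 0"
  fix \<mu> \<nu> :: "nat \<Rightarrow> nat"
  assume rows: "\<mu> \<in> row_labels m n j" "\<nu> \<in> row_labels m n j"
    and eq: "(\<Sum>t\<in>?T. B ^ t * \<mu> t) = (\<Sum>t\<in>?T. B ^ t * \<nu> t)"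
  have sum: "(\<Sum>t<Suc m. B ^ t * ?d \<kappa> t) = (\<Sum>t\<in>?T. B ^ t * \<kappa> t)" for \<kappa>
    by (rule sum.mono_neutral_cong_right) auto
  have less: "?d \<kappa> t < B" if "\<kappa> \<in> row_labels m n j" for \<kappa> t
  proof (cases "t \<in> ?T")
    case True
    then have "\<kappa> t < n t"
      using PiE_mem[OF that[unfolded row_labels_def] True] by simp
    also have "n t \<le> B"
      using True assms(1)[of t] by blast
    finally show ?thesis
      unfolding if_P[OF True] .
  next
    case False
    show ?thesis
      unfolding if_not_P[OF False] by (rule assms(2))
  qed
  have digits: "?d \<mu> t = ?d \<nu> t" if "t < Suc m" for t
    using digits_unique[of "Suc m" "?d \<mu>" B "?d \<nu>" t] less[OF rows(1)] less[OF rows(2)] eq that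
    unfolding sum by blast
  have "\<mu> t = \<nu> t" if "t \<in> ?T" for t
  proof -
    have "t < Suc m"
      using that by auto
    then show ?thesis
      using digits[of t] unfolding if_P[OF that] by blast
  qed
  then show "\<mu> = \<nu>"
    using rows unfolding row_labels_def by (meson PiE_ext)
qed

text \<open>The number of row labels is the product of the n t over the modes other than 1 and j. As
  n j \<le> n 3, it is smallest for j = 3, where it equals the bound on r.\<close>

lemma exists_row_selection:
  assumes n_mono: "\<And>i j. 1 \<le> i \<Longrightarrow> i \<le> j \<Longrightarrow> j \<le> m \<Longrightarrow> n j \<le> n i"
    and n_pos: "\<And>j. 1 \<le> j \<Longrightarrow> j \<le> m \<Longrightarrow> 1 \<le> n j"
    and r: "r \<le> (\<Prod>j=2..m. n j) div n 3" and j: "3 \<le> j" "j \<le> m"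
  shows "\<exists>\<mu>. inj_on \<mu> {..<r} \<and> \<mu> ` {..<r} \<subseteq> row_labels m n j"
proof -
  have "0 < n 3" "0 < n j" "n j \<le> n 3"
    using n_pos[of 3] n_pos[of j] n_mono[of 3 j] j by auto
  have "card (row_labels m n j) = (\<Prod>t\<in>{1..m} - {1, j}. n t)"
    unfolding row_labels_def by (simp add: card_PiE)
  also have "{1..m} - {1, j} = {2..m} - {j}"
    by auto
  finally have card: "card (row_labels m n j) = (\<Prod>t\<in>{2..m} - {j}. n t)" .
  have prod: "(\<Prod>t=2..m. n t) = n i * (\<Prod>t\<in>{2..m} - {i}. n t)" if "i \<in> {2..m}" for i
    using that by (simp add: prod.remove)
  have "r \<le> (\<Prod>t\<in>{2..m} - {3}. n t)"
    using r prod[of 3] j \<open>0 < n 3\<close> by auto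
  moreover have "(\<Prod>t\<in>{2..m} - {3}. n t) \<le> (\<Prod>t\<in>{2..m} - {j}. n t)"
  proof -
    have "n j * (\<Prod>t\<in>{2..m} - {3}. n t) \<le> n 3 * (\<Prod>t\<in>{2..m} - {3}. n t)"
      using \<open>n j \<le> n 3\<close> by simp
    also have "\<dots> = n j * (\<Prod>t\<in>{2..m} - {j}. n t)"
      using prod[of 3] prod[of j] j by auto
    finally show ?thesis
      using \<open>0 < n j\<close> by simp
  qed
  moreover have "finite (row_labels m n j)"
    unfolding row_labels_def by (intro finite_PiE) auto
  ultimately have "\<exists>\<mu>. \<mu> ` {..<r} \<subseteq> row_labels m n j \<and> inj_on \<mu> {..<r}"
    using card by (intro card_le_inj) auto
  then show ?thesis
    by blast
qed

section \<open>The Vandermonde witness\<close>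

lemma two_power_eq_iff: "(2 :: complex) ^ a = 2 ^ b \<longleftrightarrow> a = b"
proof -
  have "(2 :: complex) ^ a = 2 ^ b \<longleftrightarrow> of_nat (2 ^ a) = (of_nat (2 ^ b) :: complex)"
    by simp
  also have "\<dots> \<longleftrightarrow> (2 :: nat) ^ a = 2 ^ b"
    by (rule of_nat_eq_iff)
  finally show ?thesis
    by simp
qed

text \<open>
  The powers of \<open>n 1\<close> read a row label as the digits of a number, so that distinct row labels give
  distinct Vandermonde nodes.
\<close>
definition vandermonde_factors :: "(nat \<Rightarrow> nat) \<Rightarrow> nat \<Rightarrow> nat \<Rightarrow> complex vec" where
  "vandermonde_factors n s t =
     (if t = 1 then unit_vec (n 1) s else vec (n t) (\<lambda>i. 2 ^ (s * (n 1 ^ t * i))))"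

lemma vandermonde_factors_index:
  "t \<noteq> 1 \<Longrightarrow> i < n t \<Longrightarrow> vandermonde_factors n s t $ i = 2 ^ (s * (n 1 ^ t * i))"
  by (simp add: vandermonde_factors_def)

text \<open>All exponents in the witness are multiples of s, so the product is the s-th power of a
  node that depends on \<mu> alone.\<close>

lemma mode_prod_vandermonde_factors:
  assumes "\<mu> \<in> row_labels m n j"
  shows "mode_prod m j (vandermonde_factors n s) \<mu> = (2 ^ (\<Sum>t\<in>{1..m} - {1, j}. n 1 ^ t * \<mu> t)) ^ s"
proof -
  have "mode_prod m j (vandermonde_factors n s) \<mu> = (\<Prod>t\<in>{1..m} - {1, j}. 2 ^ (s * (n 1 ^ t * \<mu> t)))"
    unfolding mode_prod_def
    using PiE_mem[OF assms[unfolded row_labels_def]]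
    by (intro prod.cong vandermonde_factors_index) blast+
  also have "\<dots> = 2 ^ ((\<Sum>t\<in>{1..m} - {1, j}. n 1 ^ t * \<mu> t) * s)"
    unfolding power_sum[symmetric] sum_distrib_left[symmetric] by (simp only: mult.commute)
  finally show ?thesis
    by (simp only: power_mult)
qed

lemma det_mode_prod_mat_vandermonde_factors:
  assumes "\<And>t. t \<in> {1..m} \<Longrightarrow> n t \<le> n 1" "0 < n 1"
    and \<mu>: "inj_on \<mu> {..<r}" "\<mu> ` {..<r} \<subseteq> row_labels m n j"
  shows "det (mode_prod_mat m r j (vandermonde_factors n) \<mu>) \<noteq> 0"
proof -
  let ?e = "\<lambda>\<mu>. \<Sum>t\<in>{1..m} - {1, j}. n 1 ^ t * \<mu> t"
  have "mode_prod_mat m r j (vandermonde_factors n) \<mu> = mat r r (\<lambda>(i, s). (2 ^ ?e (\<mu> i)) ^ s)"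
    unfolding mode_prod_mat_def
    using \<mu>(2) by (intro cong_mat) (auto intro!: mode_prod_vandermonde_factors simp del: One_nat_def)
  moreover have "inj_on (\<lambda>i. ?e (\<mu> i)) {..<r}"
    using comp_inj_on[OF \<mu>(1) inj_on_subset[OF inj_on_row_labels[OF assms(1,2)] \<mu>(2)]]
    by (simp add: comp_def del: One_nat_def)
  then have "inj_on (\<lambda>i. 2 ^ ?e (\<mu> i) :: complex) {..<r}"
    by (simp only: inj_on_def two_power_eq_iff)
  ultimately show ?thesis
    using det_vandermonde_nonzero by simp
qed

lemma first_mode_mat_vandermonde_factors:
  "r \<le> n 1 \<Longrightarrow> first_mode_mat r (vandermonde_factors n) = 1\<^sub>m r"
  unfolding first_mode_mat_def by (rule eq_matI) (auto simp: vandermonde_factors_def)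

text \<open>This gives B the shape K diag(z) C with the same K and C as in the slice for k = 0, as
  \<open>det_krylov_mat_nonzero_iff\<close> requires.\<close>

lemma slice_mat_outer_sum_ratio:
  assumes \<mu>: "\<mu> ` {..<r} \<subseteq> row_labels m n j" "r \<le> n 1" "k < n j" "2 \<le> j" "j \<le> m"
    and lead: "\<And>s. s < r \<Longrightarrow> v s j $ 0 \<noteq> 0"
  shows "slice_mat r j k \<mu> (outer_sum m n r v) =
    mode_prod_mat m r j v \<mu> * diag_of r (\<lambda>s. v s j $ k / v s j $ 0) *
      (diag_of r (\<lambda>s. v s j $ 0) * (first_mode_mat r v)\<^sup>T)"
proof -
  have V: "(first_mode_mat r v)\<^sup>T \<in> carrier_mat r r"
    by (simp add: first_mode_mat_carrier)
  have "diag_of r (\<lambda>s. v s j $ k) = diag_of r (\<lambda>s. v s j $ k / v s j $ 0 * v s j $ 0)"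
    unfolding diag_of_def using lead by (intro cong_mat) auto
  then have "diag_of r (\<lambda>s. v s j $ k) * (first_mode_mat r v)\<^sup>T =
      diag_of r (\<lambda>s. v s j $ k / v s j $ 0) * (diag_of r (\<lambda>s. v s j $ 0) * (first_mode_mat r v)\<^sup>T)"
    by (simp add: diag_of_mult_diag_of flip: assoc_mult_mat[OF diag_of_carrier diag_of_carrier V])
  then show ?thesis
    unfolding slice_mat_outer_sum[OF \<mu>]
    by (simp only: assoc_mult_mat[OF mode_prod_mat_carrier diag_of_carrier diag_first_mode_mat_carrier])
qed

section \<open>Generic weights\<close>

lemma finite_Upsilon: "finite (Upsilon m n)"
proof -
  have "Upsilon m n = (SIGMA j:{3..m}. {1..<n j})"
    unfolding Upsilon_def by auto
  then show ?thesis
    by simp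
qed

context general_decomposition
begin

lemma generic_weights:
  assumes U31: "(3, 1) \<in> Upsilon m n" and inj: "inj_on (ratio 3 1) {..<r}"
  shows "\<exists>V. zariski_open_in (Upsilon m n) (Upsilon m n \<rightarrow>\<^sub>E UNIV) V \<and> V \<noteq> {} \<and>
    (\<forall>\<xi>\<in>V. algorithm_succeeds m n r F \<xi>)"
proof -
  \<comment> \<open>The polynomial vanishes exactly when the \<xi> sum to zero or two of the weights
    coincide.\<close>
  define q where "q \<xi> = (\<Sum>jk\<in>Upsilon m n. \<xi> jk) *
    (\<Prod>s<r. \<Prod>s'<s. weight \<xi> s + (- 1) * weight \<xi> s')" for \<xi>
  have weight: "(\<lambda>\<xi>. weight \<xi> s) \<in> polynomial_maps (Upsilon m n)" for s
    unfolding weight_def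
    by (intro polynomial_maps_sum)
      (auto intro!: polynomial_maps.mult polynomial_maps.const polynomial_maps.coord)
  have q: "q \<in> polynomial_maps (Upsilon m n)"
    unfolding q_def[abs_def]
    by (intro polynomial_maps.mult polynomial_maps_sum polynomial_maps.coord polynomial_maps_prod
        polynomial_maps.add polynomial_maps.const weight)
  have q_nonzero: "q \<xi> \<noteq> 0 \<longleftrightarrow> (\<Sum>jk\<in>Upsilon m n. \<xi> jk) \<noteq> 0 \<and> inj_on (weight \<xi>) {..<r}" for \<xi>
  proof -
    have "inj_on (weight \<xi>) {..<r} \<longleftrightarrow> (\<forall>s<r. \<forall>s'<s. weight \<xi> s \<noteq> weight \<xi> s')"
      unfolding inj_on_def by (metis lessThan_iff nat_neq_iff order_less_trans)
    then show ?thesis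
      by (auto simp: q_def)
  qed
  \<comment> \<open>All mass on (3, 1) turns the weights into the ratios for (3, 1), which are
    distinct; so q is not identically zero.\<close>
  define \<xi>0 where "\<xi>0 = (\<lambda>jk\<in>Upsilon m n. if jk = (3, 1) then 1 else 0 :: complex)"
  have "(\<Sum>jk\<in>Upsilon m n. \<xi>0 jk) = (\<Sum>jk\<in>Upsilon m n. if jk = (3, 1) then 1 else 0)"
    unfolding \<xi>0_def by (intro sum.cong) auto
  then have "(\<Sum>jk\<in>Upsilon m n. \<xi>0 jk) = 1"
    using U31 finite_Upsilon[of m n] by simp
  moreover have "weight \<xi>0 s = ratio 3 1 s" for s
  proof -
    have "weight \<xi>0 s = (\<Sum>jk\<in>Upsilon m n. if jk = (3, 1) then ratio 3 1 s else 0)"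
      unfolding weight_def \<xi>0_def by (intro sum.cong) (auto split: if_splits)
    then show ?thesis
      using U31 finite_Upsilon[of m n] by simp
  qed
  ultimately have "q \<xi>0 \<noteq> 0"
    using inj unfolding q_nonzero by (simp add: inj_on_def)
  moreover have "\<xi>0 \<in> Upsilon m n \<rightarrow>\<^sub>E UNIV"
    unfolding \<xi>0_def by simp
  ultimately have "{\<xi> \<in> Upsilon m n \<rightarrow>\<^sub>E UNIV. q \<xi> \<noteq> 0} \<noteq> {}"
    by blast
  moreover have "algorithm_succeeds m n r F \<xi>" if "q \<xi> \<noteq> 0" for \<xi>
    using that algorithm_succeeds_if_weights_distinct unfolding q_nonzero by blast
  ultimately show ?thesis
    using zariski_open_in_nonzero[OF q subset_refl] by blast
qed

end

theorem theorem4p3: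
  fixes m r N3 :: nat and n :: "nat \<Rightarrow> nat"
  assumes "m \<ge> 3"
    and "\<And>i j. 1 \<le> i \<Longrightarrow> i \<le> j \<Longrightarrow> j \<le> m \<Longrightarrow> n j \<le> n i"
    and "\<And>j. 1 \<le> j \<Longrightarrow> j \<le> m \<Longrightarrow> 1 \<le> n j"
    and "n 3 \<ge> 2"
    and "N3 = (\<Prod>j=2..m. n j) div n 3"
    and "r \<le> min (n 1) N3"
  shows "\<exists>U. zariski_open_in (multi_indices m n) (rank_variety m n r) U \<and> U \<noteq> {} \<and>
    (\<forall>F\<in>U. tensor_rank m n F = r \<longrightarrow>
      (\<exists>V. zariski_open_in (Upsilon m n) (Upsilon m n \<rightarrow>\<^sub>E UNIV) V \<and> V \<noteq> {} \<and>
        (\<forall>\<xi>\<in>V. algorithm_succeeds m n r F \<xi>)))"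
proof -
  note m = assms(1) and n_mono = assms(2) and n_pos = assms(3)
  have r: "r \<le> n 1"
    using assms(6) by simp
  have "\<exists>\<mu>. inj_on \<mu> {..<r} \<and> \<mu> ` {..<r} \<subseteq> row_labels m n j" if "3 \<le> j" "j \<le> m" for j
    by (rule exists_row_selection) (use assms that in auto)
  then obtain \<mu> where \<mu>: "\<And>j. 3 \<le> j \<Longrightarrow> j \<le> m \<Longrightarrow> inj_on (\<mu> j) {..<r}"
    "\<And>j. 3 \<le> j \<Longrightarrow> j \<le> m \<Longrightarrow> \<mu> j ` {..<r} \<subseteq> row_labels m n j"
    by metis

  \<comment> \<open>The polynomial whose nonvanishing defines the open set\<close>
  define A where "A j F = slice_mat r j 0 (\<mu> j) F" for j F
  \<comment> \<open>The slice at index 1 along mode 3 exists because n 3 \<ge> 2.\<close>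
  define B where "B F = slice_mat r 3 1 (\<mu> 3) F" for F
  \<comment> \<open>The minors provide general position; the Krylov determinant separates the ratios
    for (3, 1).\<close>
  define p where "p F = (\<Prod>j=3..m. det (A j F)) * det (krylov_mat r (A 3 F) (B F))" for F
  have A_poly: "A j \<in> polynomial_mats (multi_indices m n) r r" if "3 \<le> j" "j \<le> m" for j
    unfolding A_def[abs_def] using that \<mu>(2)[OF that] r n_pos[of j]
    by (intro polynomial_mats_slice_mat) auto
  have B_poly: "B \<in> polynomial_mats (multi_indices m n) r r"
    unfolding B_def[abs_def] using \<mu>(2)[of 3] r assms(4) m
    by (intro polynomial_mats_slice_mat) auto
  have p_poly: "p \<in> polynomial_maps (multi_indices m n)"
    unfolding p_def[abs_def] using m
    by (intro polynomial_maps.mult polynomial_maps_prod polynomial_maps_det_krylov_mat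
        polynomial_maps_det[where a = r] A_poly B_poly) auto
  have det_A: "det (A j (outer_sum m n r v)) =
      det (mode_prod_mat m r j v (\<mu> j)) * ((\<Prod>s<r. v s j $ 0) * det (first_mode_mat r v))"
    if "3 \<le> j" "j \<le> m" for j v
    unfolding A_def using that \<mu>(2)[OF that] r n_pos[of j] by (intro det_slice_mat_outer_sum) auto
  have krylov: "det (krylov_mat r (A 3 (outer_sum m n r v)) (B (outer_sum m n r v))) \<noteq> 0 \<longleftrightarrow>
      (\<forall>s<r. (\<Sum>l<r. (diag_of r (\<lambda>s. v s 3 $ 0) * (first_mode_mat r v)\<^sup>T) $$ (s, l)) \<noteq> 0) \<and>
      inj_on (\<lambda>s. v s 3 $ 1 / v s 3 $ 0) {..<r}"
    if "det (A 3 (outer_sum m n r v)) \<noteq> 0" for v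
  proof (rule det_krylov_mat_nonzero_iff[OF mode_prod_mat_carrier diag_first_mode_mat_carrier _ _ that])
    show "A 3 (outer_sum m n r v) =
        mode_prod_mat m r 3 v (\<mu> 3) * (diag_of r (\<lambda>s. v s 3 $ 0) * (first_mode_mat r v)\<^sup>T)"
      unfolding A_def using m \<mu>(2)[of 3] r assms(4) by (intro slice_mat_outer_sum) auto
    \<comment> \<open>The leading entries are factors of det A, so the ratios are genuine
      quotients.\<close>
    have "v s 3 $ 0 \<noteq> 0" if "s < r" for s
      using \<open>det (A 3 (outer_sum m n r v)) \<noteq> 0\<close> that m by (auto simp: det_A)
    then show "B (outer_sum m n r v) =
        mode_prod_mat m r 3 v (\<mu> 3) * diag_of r (\<lambda>s. v s 3 $ 1 / v s 3 $ 0) *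
          (diag_of r (\<lambda>s. v s 3 $ 0) * (first_mode_mat r v)\<^sup>T)"
      unfolding B_def using m \<mu>(2)[of 3] r assms(4) by (intro slice_mat_outer_sum_ratio) auto
  qed
  define U where "U = {F \<in> rank_variety m n r. p F \<noteq> 0}"
  have variety: "rank_variety m n r \<subseteq> tensors m n"
    unfolding rank_variety_def tensors_def by (rule zariski_closure_subset_space) auto
  have U_open: "zariski_open_in (multi_indices m n) (rank_variety m n r) U"
    unfolding U_def using variety by (intro zariski_open_in_nonzero p_poly) (auto simp: tensors_def)

  \<comment> \<open>The open set is nonempty\<close>
  let ?v = "vandermonde_factors n" and ?F = "outer_sum m n r (vandermonde_factors n)"
  have n_le: "n t \<le> n 1" if "t \<in> {1..m}" for t
    using n_mono[of 1 t] that by simp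
  have n1: "0 < n 1"
    using n_pos[of 1] m by simp
  have lead: "?v s j $ 0 = 1" if "3 \<le> j" "j \<le> m" for s j
    using that n_pos[of j] by (subst vandermonde_factors_index) auto
  have det_A_nonzero: "det (A j ?F) \<noteq> 0" if "3 \<le> j" "j \<le> m" for j
    using that det_mode_prod_mat_vandermonde_factors[OF n_le n1 \<mu>(1,2)[OF that]]
    by (simp add: det_A lead first_mode_mat_vandermonde_factors r del: One_nat_def)
  have "det (krylov_mat r (A 3 ?F) (B ?F)) \<noteq> 0"
    unfolding krylov[OF det_A_nonzero[OF order_refl m]]
  proof (intro conjI allI impI)
    fix s assume "s < r"
    \<comment> \<open>For the witness the factor C is the identity matrix, so its row sums are
      1.\<close>
    have "(\<Sum>l<r. (diag_of r (\<lambda>s. ?v s 3 $ 0) * (first_mode_mat r ?v)\<^sup>T) $$ (s, l))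
        = (\<Sum>l<r. if l = s then 1 else 0)"
      using \<open>s < r\<close> m r
      by (intro sum.cong refl, subst diag_of_mult_index[where b = r])
        (auto simp: lead first_mode_mat_vandermonde_factors simp del: One_nat_def)
    then show "(\<Sum>l<r. (diag_of r (\<lambda>s. ?v s 3 $ 0) * (first_mode_mat r ?v)\<^sup>T) $$ (s, l)) \<noteq> 0"
      using \<open>s < r\<close> by simp
  next
    have "?v s 3 $ 1 / ?v s 3 $ 0 = 2 ^ (s * n 1 ^ 3)" for s
      using lead[OF order_refl m, of s] vandermonde_factors_index[of 3 1 n s] assms(4) by simp
    then show "inj_on (\<lambda>s. ?v s 3 $ 1 / ?v s 3 $ 0) {..<r}"
      using n1 by (simp add: inj_on_def two_power_eq_iff del: One_nat_def)
  qed
  then have "p ?F \<noteq> 0"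
    unfolding p_def using det_A_nonzero by simp
  \<comment> \<open>The nonzero minor excludes shorter decompositions, so the witness is one of the
    tensors of rank r whose closure is the variety.\<close>
  moreover have "tensor_rank m n ?F = r"
  proof (rule tensor_rank_eq_if_det_slice_mat_nonzero)
    show "tensor_decomposition m n r ?F ?v"
      unfolding tensor_decomposition_def by (auto simp: vandermonde_factors_def)
    show "det (slice_mat r 3 0 (\<mu> 3) ?F) \<noteq> 0"
      using det_A_nonzero[of 3] m unfolding A_def by simp
    show "\<mu> 3 ` {..<r} \<subseteq> row_labels m n 3"
      using \<mu>(2)[of 3] m by simp
  qed (use m r assms(4) n_pos in auto)
  then have "?F \<in> rank_variety m n r"
    unfolding rank_variety_def
    by (intro subsetD[OF zariski_closure_superset]) (simp add: outer_sum_in_tensors)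
  ultimately have U_nonempty: "U \<noteq> {}"
    unfolding U_def by blast

  \<comment> \<open>The algorithm on a tensor of the open set\<close>
  have "\<exists>V. zariski_open_in (Upsilon m n) (Upsilon m n \<rightarrow>\<^sub>E UNIV) V \<and> V \<noteq> {} \<and>
      (\<forall>\<xi>\<in>V. algorithm_succeeds m n r F \<xi>)"
    if F: "F \<in> U" and rank: "tensor_rank m n F = r" for F
  proof -
    obtain v where "tensor_decomposition m n r F v"
      using tensor_rank_decomposition[of F m n] F variety rank m unfolding U_def by auto
    then have v: "\<And>s t. s < r \<Longrightarrow> 1 \<le> t \<Longrightarrow> t \<le> m \<Longrightarrow> v s t \<in> carrier_vec (n t)"
      and F_eq: "F = outer_sum m n r v"
      unfolding tensor_decomposition_def by auto
    have A_nonzero: "det (A j F) \<noteq> 0" if "3 \<le> j" "j \<le> m" for j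
      using F that unfolding U_def p_def by auto
    \<comment> \<open>By \<open>det_A\<close> each nonzero minor of F is a product over the chosen
      decomposition, none of whose factors can vanish; these are the assumptions of
      \<open>general_decomposition\<close>.\<close>
    have dets: "det (mode_prod_mat m r j v (\<mu> j)) \<noteq> 0" "(\<Prod>s<r. v s j $ 0) \<noteq> 0"
      "det (first_mode_mat r v) \<noteq> 0" if "3 \<le> j" "j \<le> m" for j
      using A_nonzero[OF that] unfolding F_eq det_A[OF that] by auto
    obtain W where W: "W \<in> carrier_mat r r" "first_mode_mat r v * W = 1\<^sub>m r" "W * first_mode_mat r v = 1\<^sub>m r"
      using mult_mat_inverse_exists[OF first_mode_mat_carrier dets(3)[OF order_refl m]] by blast
    interpret general_decomposition m r n v "first_mode_mat r v" W
    proof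
      show "first_mode_mat r v = mat r r (\<lambda>(l, s). v s 1 $ l)"
        by (fact first_mode_mat_def)
      show "v s j $ 0 \<noteq> 0" if "s < r" "3 \<le> j" "j \<le> m" for s j
        using dets(2)[OF that(2,3)] that(1) by auto
      show "c s = 0" if "3 \<le> j" "j \<le> m"
        and sum: "\<And>\<kappa>. \<kappa> \<in> row_labels m n j \<Longrightarrow> (\<Sum>s<r. mode_prod m j (v s) \<kappa> * c s) = 0"
        and "s < r" for c s j
      proof (rule sum_mult_eq_0_imp_eq_0[OF mode_prod_mat_carrier dets(1)[OF that(1,2)] _ \<open>s < r\<close>])
        fix i assume "i < r"
        then show "(\<Sum>s<r. mode_prod_mat m r j v (\<mu> j) $$ (i, s) * c s) = 0"
          using sum[of "\<mu> j i"] \<mu>(2)[OF that(1,2)] by (auto simp: mode_prod_mat_def)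
      qed
    qed (use m r n_pos v W in auto)
    have "det (krylov_mat r (A 3 F) (B F)) \<noteq> 0"
      using F unfolding U_def p_def by auto
    then have "inj_on (ratio 3 1) {..<r}"
      using krylov[of v] A_nonzero[OF order_refl m] unfolding F_eq ratio_def[abs_def] by blast
    moreover have "(3, 1) \<in> Upsilon m n"
      using m assms(4) unfolding Upsilon_def by simp
    ultimately show ?thesis
      using generic_weights unfolding F_def F_eq by blast
  qed
  then show ?thesis
    using U_open U_nonempty by blast
qed

end
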